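(* Let $v>0$ be known, let $\lambda_0>0$ be the true value of the rate, and let $\{X(t), t\geq 0\}$ be the telegraph process with velocity $v$ and rate $\lambda_0$. Let $(\Delta_n)_{n\ge1}$ be a sequence of positive numbers with $\Delta_n\to 0$ and $n\Delta_n\to\infty$ as $n\to\infty$. Let $\eta_i=X(i\Delta_n)-X((i-1)\Delta_n)$, $i=1,\ldots,n$, and $$ \lambda_n^*=\frac32\,\frac{1}{n\Delta_n}\sum_{i=1}^n\left\{1-\frac{\eta_i^2}{v^2\Delta_n^2}\right\}. $$ Then $\lambda_n^*$ is a consistent estimator of $\lambda_0$ (i.e. $\lambda_n^*\to\lambda_0$ in probability). Moreover, if in addition $n\Delta_n^3\to 0$, then $$ \sqrt{n\Delta_n}\,(\lambda_n^*-\lambda_0)\overset{d}{\longrightarrow}N\left(0,\tfrac65\lambda_0\right)\qquad (n\to\infty), $$ where $\overset{d}{\to}$ denotes convergence in distribution.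
   Context: The telegraph process with velocity $v>0$ and rate $\lambda_0>0$ is defined by $$X(t)=V(0)\int_0^t(-1)^{N(s)}\,\mathrm{d}s,\qquad t\ge 0,$$ so $X(0)=0$, where $\{N(t),t\ge 0\}$ is a homogeneous Poisson process with rate $\lambda_0$, $N(0)=0$, and $V(0)$ is a random variable independent of $N$ taking the values $+v$ and $-v$ with probability $1/2$ each. *)

theory Defs
  imports "HOL-Probability.Probability"
begin

text \<open>
  Only the values \<open>N t\<close> with \<open>t \<ge> 0\<close> are constrained. Natural-number subtraction of increments is
  harmless because the paths are nondecreasing on \<open>[0, \<infinity>)\<close>. Right-continuity of an
  integer-valued path means that it is locally constant to the right.
\<close>
locale poisson_process = prob_space M for M :: "'a measure" +
  fixes rate :: real and N :: "real \<Rightarrow> 'a \<Rightarrow> nat"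
  assumes rate_pos: "rate > 0"
    and N_measurable: "\<And>t. 0 \<le> t \<Longrightarrow> N t \<in> measurable M (count_space UNIV)"
    and N_zero: "\<And>\<omega>. \<omega> \<in> space M \<Longrightarrow> N 0 \<omega> = 0"
    and N_mono: "\<And>\<omega> s t. \<omega> \<in> space M \<Longrightarrow> 0 \<le> s \<Longrightarrow> s \<le> t \<Longrightarrow> N s \<omega> \<le> N t \<omega>"
    and N_right_cont:
      "\<And>\<omega> t. \<omega> \<in> space M \<Longrightarrow> 0 \<le> t \<Longrightarrow> \<forall>\<^sub>F s in at_right t. N s \<omega> = N t \<omega>"
    and indep_increments:
      "\<And>(t :: nat \<Rightarrow> real) k. 0 \<le> t 0 \<Longrightarrow> mono t \<Longrightarrow>
         indep_vars (\<lambda>_. count_space UNIV) (\<lambda>i \<omega>. N (t (Suc i)) \<omega> - N (t i) \<omega>) {..<k}"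
    and poisson_increments:
      "\<And>s t. 0 \<le> s \<Longrightarrow> s < t \<Longrightarrow>
         distr M (count_space UNIV) (\<lambda>\<omega>. N t \<omega> - N s \<omega>) = measure_pmf (poisson_pmf (rate * (t - s)))"

text \<open>
  \<open>V\<close> is the initial velocity \<open>V(0)\<close>. Its independence of the whole process \<open>N\<close> is
  independence of the generated sigma-algebras; \<open>indep_var\<close> is not applicable because it needs
  both variables to have the same value type.
\<close>
locale telegraph_process = poisson_process M rate N
  for M :: "'a measure" and rate :: real and N :: "real \<Rightarrow> 'a \<Rightarrow> nat" +
  fixes v :: real and V :: "'a \<Rightarrow> real" and X :: "real \<Rightarrow> 'a \<Rightarrow> real"
  assumes v_pos: "v > 0"
    and V_measurable: "V \<in> borel_measurable M"
    and V_values: "\<And>\<omega>. \<omega> \<in> space M \<Longrightarrow> V \<omega> = v \<or> V \<omega> = - v"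
    and V_plus: "prob {\<omega> \<in> space M. V \<omega> = v} = 1 / 2"
    and V_minus: "prob {\<omega> \<in> space M. V \<omega> = - v} = 1 / 2"
    and V_indep_N:
      "indep_set (sets (vimage_algebra (space M) V borel))
         (sets (vimage_algebra (space M) (\<lambda>\<omega>. \<lambda>t\<in>{0..}. N t \<omega>)
           (PiM {0..} (\<lambda>_. count_space UNIV))))"
    and X_eq:
      "\<And>\<omega> t. \<omega> \<in> space M \<Longrightarrow> 0 \<le> t \<Longrightarrow> X t \<omega> = V \<omega> * (LBINT s:{0..t}. (- 1) ^ N s \<omega>)"

definition increment :: "(real \<Rightarrow> 'a \<Rightarrow> real) \<Rightarrow> real \<Rightarrow> nat \<Rightarrow> 'a \<Rightarrow> real" where
  "increment X \<delta> i \<omega> = X (real i * \<delta>) \<omega> - X ((real i - 1) * \<delta>) \<omega>"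

definition lambda_star ::
    "real \<Rightarrow> (nat \<Rightarrow> real) \<Rightarrow> (real \<Rightarrow> 'a \<Rightarrow> real) \<Rightarrow> nat \<Rightarrow> 'a \<Rightarrow> real" where
  "lambda_star v \<Delta> X n \<omega> =
     3 / 2 * (1 / (real n * \<Delta> n)) *
       (\<Sum>i=1..n. 1 - (increment X (\<Delta> n) i \<omega>)\<^sup>2 / (v\<^sup>2 * (\<Delta> n)\<^sup>2))"

text \<open>
  Measurability is part of the definition: \<open>measure M A = 0\<close> for non-measurable \<open>A\<close>.
\<close>
definition converges_in_prob :: "'a measure \<Rightarrow> (nat \<Rightarrow> 'a \<Rightarrow> real) \<Rightarrow> real \<Rightarrow> bool" where
  "converges_in_prob M Y c \<longleftrightarrow>
     (\<forall>n. Y n \<in> borel_measurable M) \<and>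
     (\<forall>\<epsilon>>0. (\<lambda>n. measure M {\<omega> \<in> space M. \<bar>Y n \<omega> - c\<bar> > \<epsilon>}) \<longlonglongrightarrow> 0)"

text \<open>
  The library's \<open>normal_density\<close> takes the standard deviation, whereas here \<open>s2\<close> is the variance.
\<close>
definition normal_distribution :: "real \<Rightarrow> real \<Rightarrow> real measure" where
  "normal_distribution \<mu> s2 = density lborel (\<lambda>x. ennreal (normal_density \<mu> (sqrt s2) x))"

definition converges_in_distr :: "'a measure \<Rightarrow> (nat \<Rightarrow> 'a \<Rightarrow> real) \<Rightarrow> real measure \<Rightarrow> bool" where
  "converges_in_distr M Y \<mu> \<longleftrightarrow>
     (\<forall>n. Y n \<in> borel_measurable M) \<and> weak_conv_m (\<lambda>n. distr M borel (Y n)) \<mu>"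

end

theory Submission
  imports Defs
begin

text \<open>
  Since \<open>V\<^sup>2 = v\<^sup>2\<close>, the \<open>i\<close>-th summand is \<open>Y = 1 - D\<^sup>2\<close>, where \<open>D\<close> is the mean of \<open>(-1)\<^bsup>N\<^esup>\<close>
  over the \<open>i\<close>-th interval; it depends only on the increments of \<open>N\<close> in that interval. It vanishes if
  there is no jump, which leaves an error of order \<open>\<Delta>\<^sup>2\<close> from two or more jumps; if there is exactly
  one, its relative position \<open>U\<close> is uniform on \<open>[0, 1]\<close> and \<open>Y = 4U(1 - U)\<close>. Hence
  \<open>E Y = 2/3 \<lambda>\<Delta> + O(\<Delta>\<^sup>2)\<close> and \<open>E Y\<^sup>2 = 8/15 \<lambda>\<Delta> + O(\<Delta>\<^sup>2)\<close>. Expanding the characteristic function of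
  each centred summand to second order gives the limit of the characteristic functions of
  \<open>b\<^sub>n (\<lambda>\<^sub>n\<^sup>* - \<lambda>)\<close>: it is constant for \<open>b\<^sub>n = 1\<close>, and Gaussian for \<open>b\<^sub>n = sqrt (n\<Delta>\<^sub>n)\<close>, when the bias
  \<open>b\<^sub>n O(\<Delta>\<^sub>n)\<close> vanishes because \<open>n\<Delta>\<^sub>n\<^sup>3 \<rightarrow> 0\<close>. Levy's continuity theorem concludes.
\<close>

subsection \<open>Integrals of alternating step functions\<close>

text \<open>For a path of \<open>N\<close> this is the telegraph path divided by its initial
  velocity.\<close>

definition alt_int :: "(real \<Rightarrow> nat) \<Rightarrow> real \<Rightarrow> real" where
  "alt_int f t = (LBINT s:{0..t}. (- 1) ^ f s)"

context
  fixes f :: "real \<Rightarrow> nat"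
  assumes mono_f: "mono_on {0..} f"
begin

text \<open>Through \<open>cos (pi * k) = (-1) ^ k\<close> the sign becomes a continuous function of
  a monotone one. The \<open>max 0\<close> extends \<open>f\<close> from the half-line to a monotone
  function on all reals.\<close>

lemma alt_measurable:
  "(\<lambda>s. (- 1) ^ f (max 0 s) :: real) \<in> borel_measurable borel"
proof -
  have "mono (\<lambda>s. real (f (max 0 s)))"
    using mono_f by (auto simp: mono_def mono_on_def)
  then have "(\<lambda>s. real (f (max 0 s))) \<in> borel_measurable borel"
    by (rule borel_measurable_mono)
  then have "(\<lambda>s. cos (pi * real (f (max 0 s)))) \<in> borel_measurable borel"
    by measurable
  then show ?thesis by (simp only: cos_npi2)
qed

lemma alt_integrable:
  assumes "0 \<le> a"
  shows "set_integrable lborel {a..b} (\<lambda>s. (- 1) ^ f s :: real)"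
proof -
  have [measurable]: "(\<lambda>s. (- 1) ^ f (max 0 s) :: real) \<in> borel_measurable borel"
    by (rule alt_measurable)
  have "set_integrable lborel {a..b} (\<lambda>s. (- 1) ^ f (max 0 s) :: real)"
  proof (rule set_integrable_bound[where f="\<lambda>_. 1::real"])
    show "set_integrable lborel {a..b} (\<lambda>_. 1::real)"
      by (simp add: set_integrable_def emeasure_lborel_Icc_eq)
    show "set_borel_measurable lborel {a..b} (\<lambda>s. (- 1) ^ f (max 0 s) :: real)"
      unfolding set_borel_measurable_def by measurable
  qed (simp add: power_abs)
  moreover have "set_integrable lborel {a..b} (\<lambda>s. (- 1) ^ f (max 0 s) :: real) =
      set_integrable lborel {a..b} (\<lambda>s. (- 1) ^ f s :: real)"
    using assms by (intro set_integrable_cong) (simp_all add: max_def)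
  ultimately show ?thesis by simp
qed

lemma alt_int_diff:
  assumes "0 \<le> a" "a \<le> b"
  shows "alt_int f b - alt_int f a = (LBINT s:{a<..b}. (- 1) ^ f s)"
proof -
  have eq: "{0..b} = {0..a} \<union> {a<..b}" using assms by auto
  have "set_integrable lborel {a<..b} (\<lambda>s. (- 1) ^ f s :: real)"
    by (rule set_integrable_subset[OF alt_integrable[OF assms(1), of b]]) auto
  then have "alt_int f b = alt_int f a + (LBINT s:{a<..b}. (- 1) ^ f s)"
    unfolding alt_int_def eq
    by (intro set_integral_Un alt_integrable) auto
  then show ?thesis by simp
qed

lemma alt_int_diff_const:
  assumes "0 \<le> a" "a \<le> b" "f a = f b"
  shows "alt_int f b - alt_int f a = (- 1) ^ f a * (b - a)"
proof -
  have "f s = f a" if "s \<in> {a<..b}" for s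
    using that assms mono_onD[OF mono_f, of a s] mono_onD[OF mono_f, of s b] by auto
  then have "(LBINT s:{a<..b}. (- 1) ^ f s) = (LBINT s:{a<..b}. (- 1) ^ f a :: real)"
    by (intro set_lebesgue_integral_cong) auto
  then show ?thesis
    using assms by (simp add: alt_int_diff set_integral_const)
qed

lemma alt_int_diff_abs_le:
  assumes "0 \<le> a" "a \<le> b"
  shows "\<bar>alt_int f b - alt_int f a\<bar> \<le> b - a"
proof -
  have i: "set_integrable lborel {a<..b} (\<lambda>s. (- 1) ^ f s :: real)"
    by (rule set_integrable_subset[OF alt_integrable[OF assms(1), of b]]) auto
  have j: "set_integrable lborel {a<..b} (\<lambda>s. c :: real)" for c
    using assms(2) by (simp add: set_integrable_def emeasure_lborel_Icc_eq)
  have "(LBINT s:{a<..b}. (- 1) ^ f s) \<le> (LBINT s:{a<..b}. 1 :: real)"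
    by (intro set_integral_mono i j) (simp add: minus_one_power_iff)
  moreover have "(LBINT s:{a<..b}. - 1 :: real) \<le> (LBINT s:{a<..b}. (- 1) ^ f s)"
    by (intro set_integral_mono i j) (simp add: minus_one_power_iff)
  ultimately show ?thesis
    unfolding alt_int_diff[OF assms] using assms(2) by (simp add: set_integral_const abs_le_iff)
qed

text \<open>On a subinterval without a jump the Riemann sum is exact, and the other subintervals are paid for
  by the increments of \<open>f\<close>, which telescope.\<close>

lemma alt_int_riemann_error:
  assumes "0 \<le> a" "0 \<le> h"
  shows "\<bar>alt_int f (a + real m * h) - alt_int f a - h * (\<Sum>j<m. (- 1) ^ f (a + real j * h))\<bar>
    \<le> 2 * h * (real (f (a + real m * h)) - real (f a))"
proof (induction m)
  case 0
  then show ?case by simp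
next
  case (Suc m)
  define p where "p = a + real m * h"
  define q where "q = a + real (Suc m) * h"
  have pq: "0 \<le> p" "p \<le> q" "q - p = h"
    using assms by (auto simp: p_def q_def algebra_simps)
  have fpq: "f p \<le> f q" using mono_onD[OF mono_f, of p q] pq by auto
  have "\<bar>alt_int f q - alt_int f p - h * (- 1) ^ f p\<bar> \<le> 2 * h * (real (f q) - real (f p))"
  proof (cases "f p = f q")
    case True
    then show ?thesis using alt_int_diff_const[of p q] pq by simp
  next
    case False
    \<comment> \<open>The integral and the Riemann term are each at most \<open>h\<close> in
      absolute value, whence the factor 2; a jump makes the increment of \<open>f\<close> at least
      1.\<close>
    have "\<bar>h * (- 1) ^ f p\<bar> = h" using assms by (simp add: abs_mult power_abs)
    then have "\<bar>alt_int f q - alt_int f p - h * (- 1) ^ f p\<bar> \<le> 2 * h * 1"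
      using alt_int_diff_abs_le[of p q] pq by linarith
    also have "\<dots> \<le> 2 * h * (real (f q) - real (f p))"
      using False fpq assms by (intro mult_left_mono) auto
    finally show ?thesis .
  qed
  with Suc show ?case
    unfolding p_def[symmetric] q_def[symmetric] sum.lessThan_Suc distrib_left right_diff_distrib
    by linarith
qed

text \<open>With cells of length \<open>d / m\<close> the error is at most \<open>2 * d / m\<close>
  times the total increment of \<open>f\<close>, which does not depend on \<open>m\<close>. The
  integral becomes a limit of expressions in finitely many values of \<open>f\<close>, which
  measurability and independence arguments can reach.\<close>

lemma alt_int_riemann:
  assumes "0 \<le> a" "0 \<le> d"
  shows "(\<lambda>m. d / real m * (\<Sum>j<m. (- 1) ^ f (a + real j * (d / real m))))
    \<longlonglongrightarrow> alt_int f (a + d) - alt_int f a"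
proof (rule Lim_transform2)
  show "(\<lambda>m. alt_int f (a + d) - alt_int f a) \<longlonglongrightarrow> alt_int f (a + d) - alt_int f a"
    by simp
  have "(\<lambda>m. 2 * (real (f (a + d)) - real (f a)) * d * (1 / real m)) \<longlonglongrightarrow> 2 * (real (f (a + d)) - real (f a)) * d * 0"
    by (intro tendsto_intros lim_1_over_n)
  then have lim: "(\<lambda>m. 2 * (real (f (a + d)) - real (f a)) * d * (1 / real m)) \<longlonglongrightarrow> 0"
    by simp
  show "(\<lambda>m. alt_int f (a + d) - alt_int f a -
      d / real m * (\<Sum>j<m. (- 1) ^ f (a + real j * (d / real m)))) \<longlonglongrightarrow> 0"
  proof (rule Lim_null_comparison[OF _ lim], rule eventually_sequentiallyI[of 1])
    fix m :: nat assume "1 \<le> m"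
    then show "norm (alt_int f (a + d) - alt_int f a -
      d / real m * (\<Sum>j<m. (- 1) ^ f (a + real j * (d / real m))))
      \<le> 2 * (real (f (a + d)) - real (f a)) * d * (1 / real m)"
      using alt_int_riemann_error[OF assms(1), of "d / real m" m] assms(2)
      by (simp add: algebra_simps)
  qed
qed

end

subsection \<open>Independence over disjoint intervals\<close>

context poisson_process
begin

text \<open>The \<open>D\<close> of the overview, for the interval from \<open>a\<close> to
  \<open>a + d\<close>.\<close>

definition mean_sign :: "real \<Rightarrow> real \<Rightarrow> 'a \<Rightarrow> real" where
  "mean_sign a d \<omega> = (alt_int (\<lambda>t. N t \<omega>) (a + d) - alt_int (\<lambda>t. N t \<omega>) a) / d"

text \<open>A squared Riemann sum for \<open>mean_sign\<close>, written with increments from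
  \<open>N a\<close> so that it depends on the path inside the interval only. The sign
  \<open>(-1) ^ N a\<close> dropped in this way disappears in the square.\<close>

definition grid_sq :: "nat \<Rightarrow> real \<Rightarrow> real \<Rightarrow> 'a \<Rightarrow> real" where
  "grid_sq m a d \<omega> =
     (1 / real m * (\<Sum>j<m. (- 1) ^ (N (a + real j * (d / real m)) \<omega> - N a \<omega>)))\<^sup>2"

lemma N_mono_on: "\<omega> \<in> space M \<Longrightarrow> mono_on {0..} (\<lambda>t. N t \<omega>)"
  using N_mono by (auto simp: mono_on_def)

lemma mean_sign_riemann:
  assumes "\<omega> \<in> space M" "0 \<le> a" "0 < d"
  shows "(\<lambda>m. 1 / real m * (\<Sum>j<m. (- 1) ^ N (a + real j * (d / real m)) \<omega>))
    \<longlonglongrightarrow> mean_sign a d \<omega>"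
  using tendsto_divide[OF alt_int_riemann[OF N_mono_on[OF assms(1)], of a d] tendsto_const[of d]] assms
  by (simp add: mean_sign_def)

text \<open>The process is given as measurable at each fixed time, so the integral is handled as a
  pointwise limit of Riemann sums.\<close>

lemma mean_sign_measurable [measurable]:
  assumes "0 \<le> a" "0 < d"
  shows "mean_sign a d \<in> borel_measurable M"
proof (rule borel_measurable_LIMSEQ_real)
  show "(\<lambda>m. 1 / real m * (\<Sum>j<m. (- 1) ^ N (a + real j * (d / real m)) \<omega>))
    \<longlonglongrightarrow> mean_sign a d \<omega>" if "\<omega> \<in> space M" for \<omega>
    by (rule mean_sign_riemann[OF that assms])
  have "N (a + real j * (d / real m)) \<in> measurable M (count_space UNIV)" for j m :: nat
    using assms by (intro N_measurable) simp
  then show "(\<lambda>\<omega>. 1 / real m * (\<Sum>j<m. (- 1) ^ N (a + real j * (d / real m)) \<omega>))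
      \<in> borel_measurable M" for m
    by measurable
qed

lemma abs_mean_sign_le_1:
  assumes "\<omega> \<in> space M" "0 \<le> a" "0 < d"
  shows "\<bar>mean_sign a d \<omega>\<bar> \<le> 1"
  using alt_int_diff_abs_le[OF N_mono_on[OF assms(1)], of a "a + d"] assms
  by (simp add: mean_sign_def)

lemma mean_sign_sq_le_1:
  assumes "\<omega> \<in> space M" "0 \<le> a" "0 < d"
  shows "(mean_sign a d \<omega>)\<^sup>2 \<le> 1"
  using abs_mean_sign_le_1[OF assms] by (simp add: abs_square_le_1)

lemma grid_sq_tendsto:
  assumes "\<omega> \<in> space M" "0 \<le> a" "0 < d"
  shows "(\<lambda>m. grid_sq m a d \<omega>) \<longlonglongrightarrow> (mean_sign a d \<omega>)\<^sup>2"
proof -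
  have "grid_sq m a d \<omega> = (1 / real m * (\<Sum>j<m. (- 1) ^ N (a + real j * (d / real m)) \<omega>))\<^sup>2" for m
  proof -
    have "(- 1) ^ (N (a + real j * (d / real m)) \<omega> - N a \<omega>) =
        (- 1) ^ N a \<omega> * (- 1 :: real) ^ N (a + real j * (d / real m)) \<omega>" for j
      using N_mono[OF assms(1,2), of "a + real j * (d / real m)"] assms
      by (simp add: minus_one_power_iff)
    then have "(\<Sum>j<m. (- 1) ^ (N (a + real j * (d / real m)) \<omega> - N a \<omega>)) =
        (- 1) ^ N a \<omega> * (\<Sum>j<m. (- 1 :: real) ^ N (a + real j * (d / real m)) \<omega>)"
      by (simp add: sum_distrib_left)
    then show ?thesis
      unfolding grid_sq_def by (simp add: power_mult_distrib power_divide flip: power_mult)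
  qed
  then show ?thesis
    using tendsto_power[OF mean_sign_riemann[OF assms], of 2] by simp
qed

lemma grid_sq_measurable:
  assumes "0 \<le> a" "0 < d"
  shows "grid_sq m a d \<in> borel_measurable M"
proof -
  have [measurable]: "N (a + real j * (d / real m)) \<in> measurable M (count_space UNIV)" 
     "N a \<in> measurable M (count_space UNIV)" for j :: nat
    using assms by (auto intro!: N_measurable)
  show ?thesis unfolding grid_sq_def[abs_def] by measurable
qed

text \<open>Cutting each of the \<open>n\<close> intervals into \<open>m\<close> cells gives
  \<open>n * m\<close> independent increments. The \<open>i\<close>-th factor depends only on the
  \<open>i\<close>-th block of \<open>m\<close> of them, and functions of disjoint blocks are
  independent.\<close>

lemma expectation_prod_grid_sq:
  fixes g :: "real \<Rightarrow> complex"
  assumes "0 < d" "0 < m" and [measurable]: "g \<in> borel_measurable borel" and g: "\<And>x. norm (g x) \<le> 1"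
  shows "expectation (\<lambda>\<omega>. \<Prod>i<n. g (grid_sq m (real i * d) d \<omega>)) =
    (\<Prod>i<n. expectation (\<lambda>\<omega>. g (grid_sq m (real i * d) d \<omega>)))"
proof -
  define t where "t k = real k * (d / real m)" for k
  define D where "D k \<omega> = N (t (Suc k)) \<omega> - N (t k) \<omega>" for k \<omega>
  \<comment> \<open>\<open>K i\<close> is the \<open>i\<close>-th block of cells; \<open>F i\<close>
    rebuilds \<open>grid_sq\<close> from the increments \<open>w\<close> in that block.\<close>
  define K where "K i = {i * m..<i * m + m}" for i
  define F :: "nat \<Rightarrow> (nat \<Rightarrow> nat) \<Rightarrow> real"
    where "F i w = (1 / real m * (\<Sum>j<m. (- 1) ^ (\<Sum>l<j. w (i * m + l))))\<^sup>2" for i w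
  have mono_t: "mono t"
    using assms by (auto simp: mono_def t_def intro!: divide_right_mono mult_right_mono)
  have "indep_vars (\<lambda>_. count_space UNIV) D {..<n * m}"
    using indep_increments[of t "n * m"] mono_t unfolding D_def[abs_def] by (simp add: t_def)
  then have "indep_vars (\<lambda>i. PiM (K i) (\<lambda>_. count_space UNIV)) (\<lambda>i \<omega>. restrict (\<lambda>k. D k \<omega>) (K i)) {..<n}"
  proof (rule indep_vars_restrict)
    show "K i \<subseteq> {..<n * m}" if "i \<in> {..<n}" for i
    proof -
      have "Suc i * m \<le> n * m" using that by (intro mult_right_mono) auto
      then show ?thesis by (auto simp: K_def)
    qed
    show "disjoint_family_on K {..<n}"
      unfolding disjoint_family_on_def
    proof safe
      fix i j x assume ij: "i \<noteq> j" and x: "x \<in> K i" "x \<in> K j"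
      have "x div m = i" "x div m = j"
        using x by (auto simp: K_def div_nat_eqI algebra_simps)
      with ij show "x \<in> {}" by simp
    qed
  qed
  then have ind: "indep_vars (\<lambda>_. borel) (\<lambda>i \<omega>. g (F i (restrict (\<lambda>k. D k \<omega>) (K i)))) {..<n}"
  proof (rule indep_vars_compose2)
    fix i
    have [measurable]: "(\<lambda>w. \<Sum>l<j. w (i * m + l)) \<in> measurable (PiM (K i) (\<lambda>_. count_space UNIV)) (count_space (UNIV :: nat set))"
      if "j < m" for j
    proof -
      have "(\<lambda>w. w (i * m + l)) \<in> measurable (PiM (K i) (\<lambda>_. count_space UNIV)) (count_space (UNIV :: nat set))"
        if "l < j" for l
        using that \<open>j < m\<close> by (intro measurable_component_singleton) (auto simp: K_def)
      then show ?thesis by (intro measurable_sum_nat) auto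
    qed
    have "F i \<in> borel_measurable (PiM (K i) (\<lambda>_. count_space UNIV))"
      unfolding F_def[abs_def] by (intro borel_measurable_power borel_measurable_times borel_measurable_sum measurable_const measurable_compose[OF _ measurable_count_space]) auto
    then show "(\<lambda>w. g (F i w)) \<in> borel_measurable (PiM (K i) (\<lambda>_. count_space UNIV))"
      by measurable
  qed
  have eq: "F i (restrict (\<lambda>k. D k \<omega>) (K i)) = grid_sq m (real i * d) d \<omega>" if "\<omega> \<in> space M" for i \<omega>
  proof -
    have t_eq: "t (i * m + j) = real i * d + real j * (d / real m)" for j
      using assms(2) by (simp add: t_def field_simps)
    \<comment> \<open>The truncated differences telescope because the paths are monotone.\<close>
    have D_sum: "(\<Sum>l<j. D (i * m + l) \<omega>) = N (t (i * m + j)) \<omega> - N (t (i * m)) \<omega>" for j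
    proof (induction j)
      case 0
      then show ?case by simp
    next
      case (Suc j)
      have "0 \<le> t (i * m)" using assms by (simp add: t_def)
      moreover have "t (i * m) \<le> t (i * m + j)" "t (i * m + j) \<le> t (Suc (i * m + j))"
        using monoD[OF mono_t] by simp_all
      ultimately have "N (t (i * m)) \<omega> \<le> N (t (i * m + j)) \<omega>"
        "N (t (i * m + j)) \<omega> \<le> N (t (Suc (i * m + j))) \<omega>"
        using N_mono[OF that] by auto
      with Suc show ?case by (simp add: D_def)
    qed
    \<comment> \<open>For \<open>l < j < m\<close> every index \<open>i * m + l\<close> lies in
      \<open>K i\<close>, so \<open>restrict\<close> never returns its default value.\<close>
    have "(\<Sum>l<j. restrict (\<lambda>k. D k \<omega>) (K i) (i * m + l)) = (\<Sum>l<j. D (i * m + l) \<omega>)" if "j < m" for j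
      using that by (intro sum.cong) (auto simp: K_def)
    then show ?thesis
      unfolding F_def grid_sq_def
      by (intro arg_cong[where f="\<lambda>x. (1 / real m * x)\<^sup>2"] sum.cong)
         (simp_all add: D_sum t_eq t_eq[of 0, simplified])
  qed
  have "(\<lambda>\<omega>. g (F i (restrict (\<lambda>k. D k \<omega>) (K i)))) \<in> borel_measurable M" if "i < n" for i
    using ind that by (auto simp: indep_vars_def)
  then have "expectation (\<lambda>\<omega>. \<Prod>i<n. g (F i (restrict (\<lambda>k. D k \<omega>) (K i)))) =
      (\<Prod>i<n. expectation (\<lambda>\<omega>. g (F i (restrict (\<lambda>k. D k \<omega>) (K i)))))"
    by (intro indep_vars_lebesgue_integral ind integrable_const_bound[of _ 1] AE_I2 g) auto
  also have "(\<Prod>i<n. expectation (\<lambda>\<omega>. g (F i (restrict (\<lambda>k. D k \<omega>) (K i))))) =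
      (\<Prod>i<n. expectation (\<lambda>\<omega>. g (grid_sq m (real i * d) d \<omega>)))"
    by (intro prod.cong refl Bochner_Integration.integral_cong) (simp_all add: eq)
  also have "expectation (\<lambda>\<omega>. \<Prod>i<n. g (F i (restrict (\<lambda>k. D k \<omega>) (K i)))) =
      expectation (\<lambda>\<omega>. \<Prod>i<n. g (grid_sq m (real i * d) d \<omega>))"
    by (intro Bochner_Integration.integral_cong) (simp_all add: eq)
  finally show ?thesis .
qed

text \<open>Independence is available only for finitely many increments of \<open>N\<close>, so the product formula is
  proved for Riemann sums on a grid and passed to the limit.\<close>

lemma expectation_prod_mean_sign_sq:
  fixes g :: "real \<Rightarrow> complex"
  assumes d: "0 < d" and cont: "continuous_on UNIV g" and g: "\<And>x. norm (g x) \<le> 1"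
  shows "expectation (\<lambda>\<omega>. \<Prod>i<n. g ((mean_sign (real i * d) d \<omega>)\<^sup>2)) =
    (\<Prod>i<n. expectation (\<lambda>\<omega>. g ((mean_sign (real i * d) d \<omega>)\<^sup>2)))"
proof (rule LIMSEQ_unique)
  have meas_g [measurable]: "g \<in> borel_measurable borel"
    by (rule borel_measurable_continuous_onI[OF cont])
  have [measurable]: "mean_sign (real i * d) d \<in> borel_measurable M"
      "grid_sq m (real i * d) d \<in> borel_measurable M" for i m
    using d by (auto intro!: mean_sign_measurable grid_sq_measurable)
  have conv: "(\<lambda>m. g (grid_sq m (real i * d) d \<omega>)) \<longlonglongrightarrow> g ((mean_sign (real i * d) d \<omega>)\<^sup>2)"
    if "\<omega> \<in> space M" for i \<omega>
    using cont d by (intro isCont_tendsto_compose[OF _ grid_sq_tendsto[OF that]]) (auto simp: continuous_on_eq_continuous_at)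
  \<comment> \<open>Both sides pass to the limit by dominated convergence: every factor has norm at
    most 1, and continuity of \<open>g\<close> gives the pointwise limits.\<close>
  have "(\<lambda>m. expectation (\<lambda>\<omega>. \<Prod>i<n. g (grid_sq m (real i * d) d \<omega>)))
      \<longlonglongrightarrow> expectation (\<lambda>\<omega>. \<Prod>i<n. g ((mean_sign (real i * d) d \<omega>)\<^sup>2))"
    by (rule integral_dominated_convergence[where w="\<lambda>_. 1"])
       (auto intro!: tendsto_prod conv prod_le_1 g simp flip: prod_norm)
  moreover have "eventually (\<lambda>m. expectation (\<lambda>\<omega>. \<Prod>i<n. g (grid_sq m (real i * d) d \<omega>)) =
      (\<Prod>i<n. expectation (\<lambda>\<omega>. g (grid_sq m (real i * d) d \<omega>)))) sequentially"
    using expectation_prod_grid_sq[OF d _ meas_g g] by (intro eventually_sequentiallyI[of 1]) simp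
  ultimately show "(\<lambda>m. \<Prod>i<n. expectation (\<lambda>\<omega>. g (grid_sq m (real i * d) d \<omega>)))
      \<longlonglongrightarrow> expectation (\<lambda>\<omega>. \<Prod>i<n. g ((mean_sign (real i * d) d \<omega>)\<^sup>2))"
    by (rule Lim_transform_eventually)
  show "(\<lambda>m. \<Prod>i<n. expectation (\<lambda>\<omega>. g (grid_sq m (real i * d) d \<omega>)))
      \<longlonglongrightarrow> (\<Prod>i<n. expectation (\<lambda>\<omega>. g ((mean_sign (real i * d) d \<omega>)\<^sup>2)))"
    by (intro tendsto_prod integral_dominated_convergence[where w="\<lambda>_. 1"])
       (auto intro!: conv g)
qed

end

subsection \<open>Moments of a single summand\<close>

context poisson_process
begin

text \<open>The fraction of the interval on which the sign agrees with the sign at \<open>a\<close>.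
  If there is exactly one jump, this is its relative position \<open>U\<close>, because the mean
  sign is then \<open>(-1) ^ N a * (2 * U - 1)\<close>.\<close>

definition jump_pos :: "real \<Rightarrow> real \<Rightarrow> 'a \<Rightarrow> real" where
  "jump_pos a d \<omega> = (1 + (- 1) ^ N a \<omega> * mean_sign a d \<omega>) / 2"

definition one_jump :: "real \<Rightarrow> real \<Rightarrow> 'a set" where
  "one_jump a d = {\<omega> \<in> space M. N (a + d) \<omega> - N a \<omega> = 1}"

lemma jump_pos_measurable [measurable]:
  assumes "0 \<le> a" "0 < d"
  shows "jump_pos a d \<in> borel_measurable M"
proof -
  have [measurable]: "N a \<in> measurable M (count_space UNIV)" "mean_sign a d \<in> borel_measurable M"
    using assms by (auto intro!: N_measurable)
  show ?thesis unfolding jump_pos_def[abs_def] by measurable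
qed

lemma increment_measurable:
  assumes "0 \<le> a" "0 \<le> b"
  shows "(\<lambda>\<omega>. N b \<omega> - N a \<omega>) \<in> measurable M (count_space UNIV)"
proof -
  have [measurable]: "N a \<in> measurable M (count_space UNIV)" "N b \<in> measurable M (count_space UNIV)"
    using assms by (auto intro!: N_measurable)
  show ?thesis by measurable
qed

lemma one_jump_sets [measurable]:
  assumes "0 \<le> a" "0 < d"
  shows "one_jump a d \<in> sets M"
  using increment_measurable[of a "a + d"] assms unfolding one_jump_def by simp

text \<open>With \<open>U\<close> for \<open>jump_pos\<close>, the mean sign is
  \<open>2 * U - 1\<close> up to sign, and
  \<open>1 - (2 * U - 1)\<^sup>2 = 4 * U * (1 - U)\<close>.\<close>

lemma one_minus_mean_sign_sq: "1 - (mean_sign a d \<omega>)\<^sup>2 = 4 * jump_pos a d \<omega> * (1 - jump_pos a d \<omega>)"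
proof -
  have "((- 1) ^ N a \<omega>)\<^sup>2 = (1 :: real)" by (simp flip: power_mult)
  then have "((- 1) ^ N a \<omega> * mean_sign a d \<omega>)\<^sup>2 = (mean_sign a d \<omega>)\<^sup>2"
    by (simp add: power_mult_distrib)
  then show ?thesis
    by (simp add: jump_pos_def power2_eq_square field_simps)
qed

text \<open>The jump-free stretch of length \<open>e\<close> contributes \<open>e\<close> to the
  integral normalised by the initial sign, and the rest at least \<open>e - d\<close>; the total
  \<open>2 * e - d\<close> corresponds to the fraction \<open>e / d\<close>.\<close>

lemma jump_pos_ge:
  assumes "\<omega> \<in> space M" "0 \<le> a" "0 < d" "0 \<le> e" "e \<le> d" "N (a + e) \<omega> = N a \<omega>"
  shows "e / d \<le> jump_pos a d \<omega>"
proof -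
  define I where "I = alt_int (\<lambda>t. N t \<omega>)"
  define s :: real where "s = (- 1) ^ N a \<omega>"
  have ss: "s * s = 1" "\<bar>s\<bar> = 1" by (auto simp: s_def power_abs simp flip: power_add)
  have "I (a + e) - I a = s * e"
    using alt_int_diff_const[OF N_mono_on[OF assms(1)], of a "a + e"] assms by (simp add: I_def s_def)
  then have 1: "s * (I (a + e) - I a) = e" using ss by (simp flip: mult.assoc)
  have "\<bar>I (a + d) - I (a + e)\<bar> \<le> d - e"
    using alt_int_diff_abs_le[OF N_mono_on[OF assms(1)], of "a + e" "a + d"] assms by (simp add: I_def)
  then have "\<bar>s * (I (a + d) - I (a + e))\<bar> \<le> d - e" using ss by (simp add: abs_mult)
  with 1 have "2 * e - d \<le> s * (I (a + d) - I a)" by (simp add: algebra_simps)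
  then show ?thesis
    using assms by (simp add: jump_pos_def mean_sign_def I_def s_def field_simps)
qed

text \<open>After \<open>a + e\<close> the single jump has already occurred, so this stretch carries
  the sign opposite to the initial one and contributes exactly \<open>e - d\<close>, while the
  stretch before it contributes at most \<open>e\<close>.\<close>

lemma jump_pos_le:
  assumes "\<omega> \<in> one_jump a d" "0 \<le> a" "0 < d" "0 \<le> e" "e \<le> d" "N (a + e) \<omega> = N (a + d) \<omega>"
  shows "jump_pos a d \<omega> \<le> e / d"
proof -
  have w: "\<omega> \<in> space M" "N (a + e) \<omega> = Suc (N a \<omega>)"
    using assms by (auto simp: one_jump_def)
  define I where "I = alt_int (\<lambda>t. N t \<omega>)"
  define s :: real where "s = (- 1) ^ N a \<omega>"
  have ss: "s * s = 1" "\<bar>s\<bar> = 1" by (auto simp: s_def power_abs simp flip: power_add)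
  have "I (a + d) - I (a + e) = - s * (d - e)"
    using alt_int_diff_const[OF N_mono_on[OF w(1)], of "a + e" "a + d"] assms(2-5) assms(6)[symmetric] w(2)
    by (simp add: I_def s_def)
  then have 1: "s * (I (a + d) - I (a + e)) = e - d" using ss by (simp flip: mult.assoc)
  have "\<bar>I (a + e) - I a\<bar> \<le> e"
    using alt_int_diff_abs_le[OF N_mono_on[OF w(1)], of a "a + e"] assms by (simp add: I_def)
  then have "\<bar>s * (I (a + e) - I a)\<bar> \<le> e" using ss by (simp add: abs_mult)
  with 1 have "s * (I (a + d) - I a) \<le> 2 * e - d" by (simp add: algebra_simps)
  then have "s * (I (a + d) - I a) / d \<le> (2 * e - d) / d"
    using assms by (intro divide_right_mono) auto
  then show ?thesis
    using assms unfolding jump_pos_def mean_sign_def I_def s_def times_divide_eq_right diff_divide_distrib[of "2 * e"]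
    by (simp add: mult.commute[of 2 e])
qed

text \<open>Given exactly one jump, \<open>jump_pos\<close> is its position, so its distribution
  function can be read off from the increments of \<open>N\<close>. The two preceding bounds give
  one direction each.\<close>

lemma jump_pos_le_iff:
  assumes w: "\<omega> \<in> one_jump a d" and "0 \<le> a" "0 < d" "0 \<le> x" "x < 1"
  shows "jump_pos a d \<omega> \<le> x \<longleftrightarrow> N (a + x * d) \<omega> \<noteq> N a \<omega>"
proof
  have [simp]: "\<omega> \<in> space M" using w by (simp add: one_jump_def)
  have xd: "0 \<le> x * d" "x * d < d" using assms by auto
  show "N (a + x * d) \<omega> \<noteq> N a \<omega>" if le: "jump_pos a d \<omega> \<le> x"
  proof
    assume eq: "N (a + x * d) \<omega> = N a \<omega>"
    \<comment> \<open>Right-continuity prolongs the jump-free stretch to some \<open>s\<close>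
      strictly beyond \<open>a + x * d\<close>, so the position exceeds \<open>x\<close> strictly;
      \<open>x < 1\<close> leaves room for \<open>s\<close> inside the interval.\<close>
    have "\<forall>\<^sub>F s in at_right (a + x * d). N s \<omega> = N (a + x * d) \<omega>"
      using assms xd by (intro N_right_cont) auto
    moreover have "\<forall>\<^sub>F s in at_right (a + x * d). s \<in> {a + x * d<..<a + d}"
      using xd by (intro eventually_at_right_less eventually_at_rightI) auto
    ultimately have "\<forall>\<^sub>F s in at_right (a + x * d). N s \<omega> = N a \<omega> \<and> s \<in> {a + x * d<..<a + d}"
      by eventually_elim (simp add: eq)
    then obtain s where s: "N s \<omega> = N a \<omega>" "a + x * d < s" "s < a + d"
      using eventually_happens[of _ "at_right (a + x * d)"] by auto
    have "(s - a) / d \<le> jump_pos a d \<omega>"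
      using s assms xd by (intro jump_pos_ge) auto
    with le have "(s - a) / d \<le> x" by simp
    with s assms show False by (simp add: field_simps)
  qed
  show "jump_pos a d \<omega> \<le> x" if ne: "N (a + x * d) \<omega> \<noteq> N a \<omega>"
  proof -
    have "N a \<omega> \<le> N (a + x * d) \<omega>" "N (a + x * d) \<omega> \<le> N (a + d) \<omega>"
      using N_mono[of \<omega> a "a + x * d"] N_mono[of \<omega> "a + x * d" "a + d"] assms xd by auto
    then have "N (a + x * d) \<omega> = N (a + d) \<omega>" using w ne by (auto simp: one_jump_def)
    then show ?thesis using jump_pos_le[of \<omega> a d "x * d"] assms xd by simp
  qed
qed

section \<open>Poisson probabilities and the uniform law of the jump position\<close>

lemma prob_increment:
  assumes "0 \<le> s" "s < t"
  shows "prob {\<omega> \<in> space M. N t \<omega> - N s \<omega> = k} =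
    (rate * (t - s)) ^ k / fact k * exp (- (rate * (t - s)))"
proof -
  have "prob {\<omega> \<in> space M. N t \<omega> - N s \<omega> = k} =
      measure (distr M (count_space UNIV) (\<lambda>\<omega>. N t \<omega> - N s \<omega>)) {k}"
    using increment_measurable[of s t] assms
    by (subst measure_distr) (auto intro!: arg_cong[where f=prob])
  also have "\<dots> = pmf (poisson_pmf (rate * (t - s))) k"
    by (simp add: poisson_increments[OF assms] pmf.rep_eq)
  finally show ?thesis using rate_pos assms by simp
qed

lemma prob_one_jump:
  assumes "0 \<le> a" "0 < d"
  shows "prob (one_jump a d) = rate * d * exp (- (rate * d))"
  using prob_increment[of a "a + d" 1] assms by (simp add: one_jump_def)

lemma prob_two_increments:
  assumes "0 \<le> r" "r < s" "s < t"
  shows "prob {\<omega> \<in> space M. N s \<omega> - N r \<omega> = j \<and> N t \<omega> - N s \<omega> = k} =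
    prob {\<omega> \<in> space M. N s \<omega> - N r \<omega> = j} * prob {\<omega> \<in> space M. N t \<omega> - N s \<omega> = k}"
proof -
  \<comment> \<open>The time sequence must be monotone on all of the naturals, so it stays at
    \<open>t\<close> from index 2 on; only the first two increments are used.\<close>
  define \<tau> :: "nat \<Rightarrow> real" where "\<tau> i = (if i = 0 then r else if i = 1 then s else t)" for i
  define K :: "nat \<Rightarrow> nat set" where "K i = (if i = 0 then {j} else {k})" for i
  have "indep_vars (\<lambda>_. count_space UNIV) (\<lambda>i \<omega>. N (\<tau> (Suc i)) \<omega> - N (\<tau> i) \<omega>) {..<2}"
    using assms by (intro indep_increments) (auto simp: \<tau>_def mono_def)
  then have "prob (\<Inter>i\<in>{..<2}. (\<lambda>\<omega>. N (\<tau> (Suc i)) \<omega> - N (\<tau> i) \<omega>) -` K i \<inter> space M) =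
      (\<Prod>i\<in>{..<2}. prob ((\<lambda>\<omega>. N (\<tau> (Suc i)) \<omega> - N (\<tau> i) \<omega>) -` K i \<inter> space M))"
    by (rule indep_varsD) (auto simp: lessThan_Suc numeral_2_eq_2)
  moreover have "(\<Inter>i\<in>{..<2}. (\<lambda>\<omega>. N (\<tau> (Suc i)) \<omega> - N (\<tau> i) \<omega>) -` K i \<inter> space M) =
      {\<omega> \<in> space M. N s \<omega> - N r \<omega> = j \<and> N t \<omega> - N s \<omega> = k}"
    by (auto simp: \<tau>_def K_def lessThan_Suc numeral_2_eq_2)
  moreover have "(\<lambda>\<omega>. N (\<tau> (Suc 0)) \<omega> - N (\<tau> 0) \<omega>) -` K 0 \<inter> space M = {\<omega> \<in> space M. N s \<omega> - N r \<omega> = j}"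
      "(\<lambda>\<omega>. N (\<tau> (Suc 1)) \<omega> - N (\<tau> 1) \<omega>) -` K 1 \<inter> space M = {\<omega> \<in> space M. N t \<omega> - N s \<omega> = k}"
    by (auto simp: \<tau>_def K_def)
  ultimately show ?thesis by (simp add: lessThan_Suc numeral_2_eq_2 mult.commute)
qed

text \<open>This is uniformity given one jump. For \<open>0 < x < 1\<close> the event says one jump
  up to \<open>a + x * d\<close> and none after; the two exponentials multiply to
  \<open>exp (- (rate * d))\<close> and leave the factor \<open>x\<close>.\<close>

lemma prob_jump_pos:
  assumes "0 \<le> a" "0 < d" "0 \<le> x" "x \<le> 1"
  shows "prob {\<omega> \<in> one_jump a d. jump_pos a d \<omega> \<le> x} = x * prob (one_jump a d)"
proof -
  \<comment> \<open>The endpoints are treated apart because the Poisson law of increments is stated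
    for intervals of positive length.\<close>
  consider "x = 0" | "x = 1" | "0 < x" "x < 1" using assms by linarith
  then show ?thesis
  proof cases
    case 1
    then have "{\<omega> \<in> one_jump a d. jump_pos a d \<omega> \<le> x} = {}"
      using jump_pos_le_iff[of _ a d 0] assms by auto
    with 1 show ?thesis by (simp only: measure_empty mult_zero_left)
  next
    case 2
    have "jump_pos a d \<omega> \<le> 1" if "\<omega> \<in> one_jump a d" for \<omega>
      using jump_pos_le[OF that, of d] assms by simp
    then have "{\<omega> \<in> one_jump a d. jump_pos a d \<omega> \<le> x} = one_jump a d" using 2 by auto
    with 2 show ?thesis by simp
  next
    case 3
    then have xd: "0 < x * d" "x * d < d" using assms by auto
    have "{\<omega> \<in> one_jump a d. jump_pos a d \<omega> \<le> x} =
      {\<omega> \<in> space M. N (a + x * d) \<omega> - N a \<omega> = 1 \<and> N (a + d) \<omega> - N (a + x * d) \<omega> = 0}" (is "?L = ?R")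
    proof -
      have "\<omega> \<in> ?L \<longleftrightarrow> \<omega> \<in> ?R" if w: "\<omega> \<in> space M" for \<omega>
      proof -
        have "N a \<omega> \<le> N (a + x * d) \<omega>" "N (a + x * d) \<omega> \<le> N (a + d) \<omega>"
          using N_mono[OF w, of a "a + x * d"] N_mono[OF w, of "a + x * d" "a + d"] assms xd by auto
        then show ?thesis
          using jump_pos_le_iff[of \<omega> a d x] assms 3 w by (auto simp: one_jump_def)
      qed
      then show ?thesis by (auto simp: one_jump_def)
    qed
    also have "prob \<dots> = rate * (x * d) * exp (- (rate * (x * d))) * exp (- (rate * (d - x * d)))"
      using assms xd by (simp add: prob_two_increments prob_increment del: diff_is_0_eq)
    also have "\<dots> = x * (rate * d * exp (- (rate * d)))"
      by (simp add: algebra_simps flip: exp_add)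
    finally show ?thesis using assms by (simp add: prob_one_jump)
  qed
qed

text \<open>Under the conditional measure \<open>U\<close> given \<open>one_jump\<close>, the
  preceding distribution function makes \<open>jump_pos\<close> uniform on the unit interval.
  Writing \<open>U\<close> as a density with respect to \<open>M\<close> removes the
  conditioning.\<close>

lemma expectation_one_jump:
  fixes g :: "real \<Rightarrow> real"
  assumes "0 \<le> a" "0 < d" and [measurable]: "g \<in> borel_measurable borel"
  shows "expectation (\<lambda>\<omega>. indicator (one_jump a d) \<omega> * g (jump_pos a d \<omega>)) =
    prob (one_jump a d) * (LBINT x:{0..1}. g x)"
proof -
  define A where "A = one_jump a d"
  define U where "U = uniform_measure M A"
  have [measurable]: "A \<in> sets M" "jump_pos a d \<in> borel_measurable M"
    using assms by (auto simp: A_def)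
  have pA: "prob A > 0" using prob_one_jump[of a d] assms rate_pos by (simp add: A_def)
  then have eA: "emeasure M A \<noteq> 0" "emeasure M A \<noteq> \<infinity>" by (auto simp: emeasure_eq_measure)
  interpret U: prob_space U
    unfolding U_def using eA by (rule prob_space_uniform_measure)
  have "distributed U lborel (jump_pos a d) (\<lambda>x. indicator {0..1} x / measure lborel {0..1::real})"
  proof (rule U.uniform_distrI_borel_atLeastAtMost)
    show "jump_pos a d \<in> borel_measurable U" unfolding U_def by measurable
    show "U.prob {\<omega> \<in> space U. jump_pos a d \<omega> \<le> x} = (x - 0) / (1 - 0)" if "0 \<le> x" "x \<le> 1" for x
    proof -
      have "A \<inter> {\<omega> \<in> space M. jump_pos a d \<omega> \<le> x} = {\<omega> \<in> A. jump_pos a d \<omega> \<le> x}"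
        by (auto simp: A_def one_jump_def)
      then show ?thesis
        using pA that assms eA by (simp add: U_def measure_uniform_measure prob_jump_pos A_def[symmetric])
          (simp add: A_def prob_jump_pos)
    qed
  qed simp
  from distributed_integral[OF this, of g]
  have "U.expectation (\<lambda>\<omega>. g (jump_pos a d \<omega>)) = (LBINT x:{0..1}. g x)"
    by (simp add: set_lebesgue_integral_def)
  moreover have "U = density M (\<lambda>\<omega>. ennreal (indicator A \<omega> / prob A))"
    unfolding U_def uniform_measure_def using pA
    by (intro density_cong) (auto simp: emeasure_eq_measure divide_ennreal split: split_indicator
        intro!: AE_I2 simp flip: ennreal_1)
  ultimately have "expectation (\<lambda>\<omega>. indicator A \<omega> / prob A * g (jump_pos a d \<omega>)) = (LBINT x:{0..1}. g x)"
    using pA by (simp add: integral_real_density)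
  moreover have "expectation (\<lambda>\<omega>. indicator A \<omega> * g (jump_pos a d \<omega>)) =
      prob A * expectation (\<lambda>\<omega>. indicator A \<omega> / prob A * g (jump_pos a d \<omega>))"
    using pA by (subst integral_mult_right_zero[symmetric]) (intro Bochner_Integration.integral_cong, auto)
  ultimately show ?thesis by (simp add: A_def)
qed

text \<open>With \<open>x = rate * d\<close> the probability is
  \<open>1 - (1 + x) * exp (- x)\<close>, and \<open>exp (- x) \<ge> 1 - x\<close> bounds it by
  \<open>1 - (1 + x) * (1 - x)\<close>.\<close>

lemma prob_two_jumps_le:
  assumes "0 \<le> a" "0 < d"
  shows "prob {\<omega> \<in> space M. 2 \<le> N (a + d) \<omega> - N a \<omega>} \<le> (rate * d)\<^sup>2"
proof -
  define x where "x = rate * d"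
  have x: "0 < x" using rate_pos assms by (simp add: x_def)
  define Z where "Z = {\<omega> \<in> space M. N (a + d) \<omega> - N a \<omega> = 0}"
  have [measurable]: "(\<lambda>\<omega>. N (a + d) \<omega> - N a \<omega>) \<in> measurable M (count_space UNIV)"
    using assms by (intro increment_measurable) auto
  have "Z = (\<lambda>\<omega>. N (a + d) \<omega> - N a \<omega>) -` {0} \<inter> space M" by (auto simp: Z_def)
  also have "\<dots> \<in> sets M" by (rule measurable_sets[where A="count_space UNIV"]) auto
  finally have [measurable]: "Z \<in> sets M" .
  have [measurable]: "one_jump a d \<in> sets M"
    using assms by (rule one_jump_sets)
  have "{\<omega> \<in> space M. 2 \<le> N (a + d) \<omega> - N a \<omega>} = space M - (Z \<union> one_jump a d)"
    by (auto simp: Z_def one_jump_def)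
  then have "prob {\<omega> \<in> space M. 2 \<le> N (a + d) \<omega> - N a \<omega>} = 1 - prob (Z \<union> one_jump a d)"
    by (simp add: prob_compl)
  also have "prob (Z \<union> one_jump a d) = prob Z + prob (one_jump a d)"
  proof (rule finite_measure_Union)
    show "Z \<inter> one_jump a d = {}" by (auto simp: Z_def one_jump_def)
  qed measurable
  also have "prob Z = exp (- x)"
    using prob_increment[of a "a + d" 0] assms by (simp add: Z_def x_def del: diff_is_0_eq)
  also have "prob (one_jump a d) = x * exp (- x)"
    using assms by (simp add: prob_one_jump x_def)
  also have "1 - (exp (- x) + x * exp (- x)) \<le> x\<^sup>2"
  proof -
    have "(1 - x) * (1 + x) \<le> exp (- x) * (1 + x)"
      using x exp_ge_add_one_self[of "- x"] by (intro mult_right_mono) auto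
    then show ?thesis by (simp add: power2_eq_square algebra_simps)
  qed
  finally show ?thesis by (simp add: x_def)
qed

text \<open>Split by the number of jumps, with \<open>x = rate * d\<close>: none gives 0, as
  \<open>p > 0\<close>; exactly one gives \<open>c * x * exp (- x)\<close> through the uniform
  position; two or more contribute at most their probability, which is at most
  \<open>x\<^sup>2\<close>.\<close>

lemma moment_approx:
  fixes p :: nat and a d :: real
  defines "c \<equiv> LBINT x:{0..1}. (4 * x * (1 - x)) ^ p :: real"
  assumes ad: "0 \<le> a" "0 < d" and p: "0 < p" and c: "0 \<le> c" "c \<le> 1"
  shows "\<bar>expectation (\<lambda>\<omega>. (1 - (mean_sign a d \<omega>)\<^sup>2) ^ p) - c * (rate * d)\<bar> \<le> (rate * d)\<^sup>2"
proof -
  define x where "x = rate * d"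
  have x: "0 < x" using rate_pos ad by (simp add: x_def)
  define Y where "Y \<omega> = (1 - (mean_sign a d \<omega>)\<^sup>2) ^ p" for \<omega>
  define A where "A = one_jump a d"
  define B where "B = {\<omega> \<in> space M. 2 \<le> N (a + d) \<omega> - N a \<omega>}"
  have [measurable]: "(\<lambda>\<omega>. N (a + d) \<omega> - N a \<omega>) \<in> measurable M (count_space UNIV)"
    using ad by (intro increment_measurable) auto
  have [measurable]: "A \<in> sets M" "B \<in> sets M" "mean_sign a d \<in> borel_measurable M"
    using ad by (auto simp: A_def B_def)
  have Y01: "0 \<le> Y \<omega>" "Y \<omega> \<le> 1" if "\<omega> \<in> space M" for \<omega>
    using mean_sign_sq_le_1[OF that ad] by (auto simp: Y_def intro!: power_le_one)
  have [measurable]: "Y \<in> borel_measurable M" unfolding Y_def[abs_def] by measurable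
  have split: "Y \<omega> = indicator A \<omega> * Y \<omega> + indicator B \<omega> * Y \<omega>" if w: "\<omega> \<in> space M" for \<omega>
  proof (cases "N (a + d) \<omega> = N a \<omega>")
    case True
    then have "mean_sign a d \<omega> = (- 1) ^ N a \<omega>"
      using alt_int_diff_const[OF N_mono_on[OF w], of a "a + d"] ad by (simp add: mean_sign_def)
    then have "Y \<omega> = 0" using p by (simp add: Y_def flip: power_mult)
    then show ?thesis by simp
  next
    case False
    have "N a \<omega> \<le> N (a + d) \<omega>" using N_mono[OF w, of a "a + d"] ad by auto
    with False w show ?thesis
      by (auto simp: A_def B_def one_jump_def split: split_indicator)
  qed
  have int: "integrable M (\<lambda>\<omega>. indicator S \<omega> * Y \<omega>)" if [measurable]: "S \<in> sets M" for S
    using Y01 by (intro integrable_const_bound[of _ 1] AE_I2) (auto split: split_indicator)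
  have "expectation Y = expectation (\<lambda>\<omega>. indicator A \<omega> * Y \<omega> + indicator B \<omega> * Y \<omega>)"
    by (rule Bochner_Integration.integral_cong) (simp_all flip: split)
  also have "\<dots> = expectation (\<lambda>\<omega>. indicator A \<omega> * Y \<omega>) + expectation (\<lambda>\<omega>. indicator B \<omega> * Y \<omega>)"
    by (intro Bochner_Integration.integral_add int) auto
  also have "expectation (\<lambda>\<omega>. indicator A \<omega> * Y \<omega>) = x * exp (- x) * c"
    unfolding A_def Y_def one_minus_mean_sign_sq
    using expectation_one_jump[OF ad, of "\<lambda>u. (4 * u * (1 - u)) ^ p"] prob_one_jump[OF ad]
    by (simp add: c_def x_def)
  finally have E: "expectation Y = x * exp (- x) * c + expectation (\<lambda>\<omega>. indicator B \<omega> * Y \<omega>)" .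
  have "expectation (\<lambda>\<omega>. indicator B \<omega> * Y \<omega>) \<le> expectation (indicator B)"
    using Y01 by (intro integral_mono int integrable_real_indicator) (auto split: split_indicator simp: emeasure_eq_measure)
  also have "\<dots> \<le> x\<^sup>2" using prob_two_jumps_le[OF ad] by (simp add: B_def x_def)
  finally have "expectation (\<lambda>\<omega>. indicator B \<omega> * Y \<omega>) \<le> x\<^sup>2" .
  moreover have "0 \<le> expectation (\<lambda>\<omega>. indicator B \<omega> * Y \<omega>)"
    using Y01 by (intro Bochner_Integration.integral_nonneg_AE AE_I2) (auto split: split_indicator)
  \<comment> \<open>The one-jump term falls short of \<open>c * x\<close> by at most
    \<open>x\<^sup>2\<close>, and the other term lies between 0 and \<open>x\<^sup>2\<close>. The
    errors have opposite signs, so they do not add up.\<close>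
  moreover have "x * exp (- x) * c \<le> x * 1 * c"
    using x c by (intro mult_right_mono mult_left_mono) auto
  moreover have "c * x - x\<^sup>2 \<le> x * exp (- x) * c"
  proof -
    have "x * (1 - x) * c \<le> x * exp (- x) * c"
      using x c exp_ge_add_one_self[of "- x"] by (intro mult_right_mono mult_left_mono) auto
    moreover have "x * x * c \<le> x * x * 1" using x c by (intro mult_left_mono) auto
    ultimately show ?thesis by (simp add: algebra_simps power2_eq_square)
  qed
  ultimately have "\<bar>expectation Y - c * x\<bar> \<le> x\<^sup>2" using E by (simp add: abs_le_iff algebra_simps)
  then show ?thesis by (simp add: Y_def[abs_def] x_def)
qed

section \<open>Values of the first two moments\<close>

lemma parabola_integral_1: "(LBINT x:{0..1}. (4 * x * (1 - x)) ^ 1) = (2 / 3 :: real)"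
proof -
  have "(LBINT x:{0..1}. (4 * x * (1 - x)) ^ 1 :: real) = (2 * 1^2 - 4 / 3 * 1^3) - (2 * 0^2 - 4 / 3 * 0^3)"
    unfolding set_lebesgue_integral_def
    by (rule integral_FTC_atLeastAtMost)
       (auto intro!: derivative_eq_intros continuous_intros simp: power2_eq_square algebra_simps
         simp flip: has_real_derivative_iff_has_vector_derivative)
  then show ?thesis by simp
qed

lemma parabola_integral_2: "(LBINT x:{0..1}. (4 * x * (1 - x)) ^ 2) = (8 / 15 :: real)"
proof -
  have "(LBINT x:{0..1}. (4 * x * (1 - x)) ^ 2 :: real) =
      (16 / 3 * 1^3 - 8 * 1^4 + 16 / 5 * 1^5) - (16 / 3 * 0^3 - 8 * 0^4 + 16 / 5 * 0^5)"
    unfolding set_lebesgue_integral_def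
    by (rule integral_FTC_atLeastAtMost)
       (auto intro!: derivative_eq_intros continuous_intros simp: power2_eq_square power3_eq_cube power4_eq_xxxx algebra_simps
         simp flip: has_real_derivative_iff_has_vector_derivative)
  then show ?thesis by simp
qed

text \<open>The factor \<open>3 / 2\<close> of \<open>lambda_star\<close> is the reciprocal of this
  \<open>2 / 3\<close>, which leaves a bias of order \<open>\<Delta> n\<close> only.\<close>

lemma first_moment:
  assumes "0 \<le> a" "0 < d"
  shows "\<bar>expectation (\<lambda>\<omega>. 1 - (mean_sign a d \<omega>)\<^sup>2) - 2 / 3 * (rate * d)\<bar> \<le> (rate * d)\<^sup>2"
  using moment_approx[OF assms, of 1] unfolding parabola_integral_1 by simp

text \<open>The squared factor \<open>9 / 4\<close> times \<open>8 / 15\<close> is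
  \<open>6 / 5\<close>, the constant of the limiting variance.\<close>

lemma second_moment:
  assumes "0 \<le> a" "0 < d"
  shows "\<bar>expectation (\<lambda>\<omega>. (1 - (mean_sign a d \<omega>)\<^sup>2)\<^sup>2) - 8 / 15 * (rate * d)\<bar> \<le> (rate * d)\<^sup>2"
  using moment_approx[OF assms, of 2] unfolding parabola_integral_2 by simp

end

subsection \<open>Limits of characteristic functions\<close>

text \<open>Second-order Taylor expansion with remainder at most
  \<open>\<bar>W\<bar> ^ 3 / 6\<close>, hence at most \<open>b / 6 * W\<^sup>2\<close>. The first
  moment stays among the errors because the summands will be centred only approximately;
  \<open>k\<close> is the target value for half the second moment.\<close>

lemma (in prob_space) expectation_iexp_approx:
  assumes [measurable]: "W \<in> borel_measurable M" and b: "\<And>\<omega>. \<omega> \<in> space M \<Longrightarrow> \<bar>W \<omega>\<bar> \<le> b"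
  shows "cmod (expectation (\<lambda>\<omega>. iexp (W \<omega>)) - (1 - of_real k)) \<le>
    \<bar>expectation W\<bar> + \<bar>expectation (\<lambda>\<omega>. (W \<omega>)\<^sup>2) / 2 - k\<bar> + b / 6 * expectation (\<lambda>\<omega>. (W \<omega>)\<^sup>2)"
proof -
  have b2: "(W \<omega>)\<^sup>2 \<le> b\<^sup>2" if "\<omega> \<in> space M" for \<omega>
    using b[OF that] by (metis abs_ge_zero power2_abs power_mono)
  have int: "integrable M W" "integrable M (\<lambda>\<omega>. (W \<omega>)\<^sup>2)"
    using b b2 by (intro integrable_const_bound[of _ b] integrable_const_bound[of _ "b\<^sup>2"] AE_I2; simp)+
  have int_e: "integrable M (\<lambda>\<omega>. iexp (W \<omega>))"
    by (intro integrable_const_bound[of _ 1]) auto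
  define T where "T \<omega> = 1 + \<i> * of_real (W \<omega>) - of_real ((W \<omega>)\<^sup>2) / 2" for \<omega>
  have int_T: "integrable M T"
    unfolding T_def[abs_def] using int
    by (intro Bochner_Integration.integrable_diff Bochner_Integration.integrable_add integrable_mult_right
        integrable_divide integrable_of_real) auto
  have "cmod (iexp (W \<omega>) - T \<omega>) \<le> b / 6 * (W \<omega>)\<^sup>2" if "\<omega> \<in> space M" for \<omega>
  proof -
    have "cmod (iexp (W \<omega>) - T \<omega>) \<le> \<bar>W \<omega>\<bar> ^ 3 / 6"
      using iexp_approx1[of "W \<omega>" 2]
      by (simp add: T_def numeral_2_eq_2 numeral_3_eq_3 fact_Suc power_mult_distrib algebra_simps)
    also have "\<bar>W \<omega>\<bar> ^ 3 = \<bar>W \<omega>\<bar> * (W \<omega>)\<^sup>2" by (simp add: power3_eq_cube power2_eq_square abs_mult)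
    also have "\<dots> / 6 \<le> b * (W \<omega>)\<^sup>2 / 6"
      using b[OF that] by (intro divide_right_mono mult_right_mono) auto
    finally show ?thesis by simp
  qed
  then have "cmod (expectation (\<lambda>\<omega>. iexp (W \<omega>) - T \<omega>)) \<le> expectation (\<lambda>\<omega>. b / 6 * (W \<omega>)\<^sup>2)"
    using int int_e int_T by (intro order_trans[OF integral_norm_bound integral_mono]) auto
  also have "expectation (\<lambda>\<omega>. iexp (W \<omega>) - T \<omega>) = expectation (\<lambda>\<omega>. iexp (W \<omega>)) - expectation T"
    using int_e int_T by (rule Bochner_Integration.integral_diff)
  also have "expectation T = 1 + \<i> * of_real (expectation W) - of_real (expectation (\<lambda>\<omega>. (W \<omega>)\<^sup>2)) / 2"
  proof -
    have "integrable M (\<lambda>\<omega>. \<i> * complex_of_real (W \<omega>))" "integrable M (\<lambda>\<omega>. complex_of_real ((W \<omega>)\<^sup>2) / 2)"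
      using int by (intro integrable_mult_right integrable_divide integrable_of_real; simp)+
    then show ?thesis
      unfolding T_def[abs_def] by (simp add: prob_space del: of_real_power)
  qed
  finally have 1: "cmod (expectation (\<lambda>\<omega>. iexp (W \<omega>)) -
      (1 + \<i> * of_real (expectation W) - of_real (expectation (\<lambda>\<omega>. (W \<omega>)\<^sup>2)) / 2)) \<le>
      b / 6 * expectation (\<lambda>\<omega>. (W \<omega>)\<^sup>2)" by simp
  define \<mu> q where "\<mu> = expectation W" and "q = expectation (\<lambda>\<omega>. (W \<omega>)\<^sup>2)"
  have "cmod (\<i> * of_real \<mu> - of_real (q / 2 - k)) \<le> cmod (\<i> * of_real \<mu>) + cmod (of_real (q / 2 - k))"
    by (rule norm_triangle_ineq4)
  also have "\<dots> = \<bar>\<mu>\<bar> + \<bar>q / 2 - k\<bar>" by (simp add: norm_mult del: of_real_diff)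
  finally have 2: "cmod (\<i> * of_real \<mu> - of_real (q / 2 - k)) \<le> \<bar>\<mu>\<bar> + \<bar>q / 2 - k\<bar>" .
  have "expectation (\<lambda>\<omega>. iexp (W \<omega>)) - (1 - of_real k) =
      (expectation (\<lambda>\<omega>. iexp (W \<omega>)) - (1 + \<i> * of_real \<mu> - of_real q / 2)) +
      (\<i> * of_real \<mu> - of_real (q / 2 - k))"
    by (simp add: algebra_simps)
  then have "cmod (expectation (\<lambda>\<omega>. iexp (W \<omega>)) - (1 - of_real k)) \<le>
      cmod (expectation (\<lambda>\<omega>. iexp (W \<omega>)) - (1 + \<i> * of_real \<mu> - of_real q / 2)) +
      cmod (\<i> * of_real \<mu> - of_real (q / 2 - k))"
    by (metis norm_triangle_ineq)
  with 1 2 show ?thesis unfolding \<mu>_def q_def by linarith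
qed

text \<open>Replacing the factors one by one, all of norm at most 1, costs at most
  \<open>n * B n\<close> in total, and \<open>(1 - L / n) ^ n\<close> tends to
  \<open>exp (- L)\<close>.\<close>

lemma prod_tendsto_exp:
  fixes z :: "nat \<Rightarrow> nat \<Rightarrow> complex" and L :: real
  assumes L: "0 \<le> L" and z: "\<And>n i. i < n \<Longrightarrow> norm (z n i) \<le> 1"
    and close: "\<forall>\<^sub>F n in sequentially. \<forall>i<n. norm (z n i - (1 - of_real (L / real n))) \<le> B n"
    and B: "(\<lambda>n. real n * B n) \<longlonglongrightarrow> 0"
  shows "(\<lambda>n. \<Prod>i<n. z n i) \<longlonglongrightarrow> of_real (exp (- L))"
proof (rule Lim_transform)
  have "(\<lambda>n. (1 + (- L) / real n) ^ n) \<longlonglongrightarrow> exp (- L)"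
    by (rule tendsto_exp_limit_sequentially)
  then have "(\<lambda>n. complex_of_real ((1 + (- L) / real n) ^ n)) \<longlonglongrightarrow> of_real (exp (- L))"
    by (rule tendsto_of_real)
  then show "(\<lambda>n. \<Prod>i<n. 1 - complex_of_real (L / real n)) \<longlonglongrightarrow> of_real (exp (- L))"
    by simp
  \<comment> \<open>For \<open>n > L / 2\<close> one has \<open>1 - L / n > -1\<close>, so the model
    factors have norm at most 1 as well.\<close>
  have "\<forall>\<^sub>F n in sequentially. L / 2 < real n \<and> 0 < n"
    using eventually_conj[OF eventually_gt_at_top[of "nat \<lceil>L / 2\<rceil>"] eventually_gt_at_top[of 0]]
    by eventually_elim linarith
  with close show "(\<lambda>n. (\<Prod>i<n. z n i) - (\<Prod>i<n. 1 - complex_of_real (L / real n))) \<longlonglongrightarrow> 0"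
  proof (intro Lim_null_comparison[OF _ B], eventually_elim)
    case (elim n)
    have "1 - complex_of_real (L / real n) = of_real (1 - L / real n)" by simp
    moreover have "\<bar>1 - L / real n\<bar> \<le> 1" using elim L by (auto simp: abs_le_iff field_simps)
    ultimately have "norm (1 - complex_of_real (L / real n)) \<le> 1" by (simp only: norm_of_real)
    then have "norm ((\<Prod>i<n. z n i) - (\<Prod>i<n. 1 - complex_of_real (L / real n))) \<le>
        (\<Sum>i<n. norm (z n i - (1 - of_real (L / real n))))"
      using z by (intro norm_prod_diff) auto
    also have "\<dots> \<le> (\<Sum>i<n. B n)" using elim by (intro sum_mono) auto
    finally show ?case by simp
  qed
qed

section \<open>Characteristic function of the centred sum\<close>

context poisson_process
begin

text \<open>The product formula for the continuous function
  \<open>\<lambda>x. iexp (c * (1 - x - m))\<close>, which has norm 1.\<close>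

lemma iexp_sum_mean_sign:
  fixes c m d :: real
  assumes "0 < d"
  shows "expectation (\<lambda>\<omega>. iexp (c * (\<Sum>i<n. 1 - (mean_sign (real i * d) d \<omega>)\<^sup>2 - m))) =
    (\<Prod>i<n. expectation (\<lambda>\<omega>. iexp (c * (1 - (mean_sign (real i * d) d \<omega>)\<^sup>2 - m))))"
proof -
  have "expectation (\<lambda>\<omega>. iexp (c * (\<Sum>i<n. 1 - (mean_sign (real i * d) d \<omega>)\<^sup>2 - m))) =
    expectation (\<lambda>\<omega>. \<Prod>i<n. iexp (c * (1 - (mean_sign (real i * d) d \<omega>)\<^sup>2 - m)))"
    by (simp add: sum_distrib_left flip: exp_sum)
  also have "\<dots> = (\<Prod>i<n. expectation (\<lambda>\<omega>. iexp (c * (1 - (mean_sign (real i * d) d \<omega>)\<^sup>2 - m))))"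
    using assms by (intro expectation_prod_mean_sign_sq[where g="\<lambda>x. iexp (c * (1 - x - m))"])
      (auto intro!: continuous_intros)
  finally show ?thesis .
qed

text \<open>Taylor expansion for \<open>W = c * (Y - 2 / 3 * x)\<close>: the first error is the
  bias, the next two compare half the second moment with \<open>k\<close>, and the last is the cubic
  remainder. Half of \<open>8 / 15\<close> gives \<open>4 / 15\<close>.\<close>

lemma char_term_approx:
  fixes c a d k :: real
  defines "x \<equiv> rate * d"
  assumes ad: "0 \<le> a" "0 < d" and x1: "x \<le> 1"
  shows "cmod (expectation (\<lambda>\<omega>. iexp (c * (1 - (mean_sign a d \<omega>)\<^sup>2 - 2 / 3 * x))) - (1 - of_real k)) \<le>
    \<bar>c\<bar> * x\<^sup>2 + \<bar>4 / 15 * c\<^sup>2 * x - k\<bar> + 2 * c\<^sup>2 * x\<^sup>2 + \<bar>c\<bar> / 6 * (c\<^sup>2 * (8 / 15 * x + 4 * x\<^sup>2))"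
proof -
  have x0: "0 < x" using rate_pos ad by (simp add: x_def)
  define Y where "Y \<omega> = 1 - (mean_sign a d \<omega>)\<^sup>2" for \<omega>
  define m where "m = 2 / 3 * x"
  define W where "W \<omega> = c * (Y \<omega> - m)" for \<omega>
  have [measurable]: "mean_sign a d \<in> borel_measurable M" using ad by auto
  have [measurable]: "Y \<in> borel_measurable M" "W \<in> borel_measurable M"
    unfolding Y_def[abs_def] W_def[abs_def] by measurable
  have Y01: "0 \<le> Y \<omega>" "Y \<omega> \<le> 1" if "\<omega> \<in> space M" for \<omega>
    using mean_sign_sq_le_1[OF that ad] by (auto simp: Y_def)
  have int: "integrable M Y" "integrable M (\<lambda>\<omega>. (Y \<omega>)\<^sup>2)"
    using Y01 by (auto intro!: integrable_const_bound[of _ 1] AE_I2 power_le_one)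
  have Wb: "\<bar>W \<omega>\<bar> \<le> \<bar>c\<bar>" if "\<omega> \<in> space M" for \<omega>
  proof -
    have "\<bar>Y \<omega> - m\<bar> \<le> 1" using Y01[OF that] x0 x1 by (auto simp: m_def abs_le_iff)
    then show ?thesis by (simp add: W_def abs_mult mult_left_le)
  qed
  define e1 e2 where "e1 = expectation Y" and "e2 = expectation (\<lambda>\<omega>. (Y \<omega>)\<^sup>2)"
  have e1: "\<bar>e1 - m\<bar> \<le> x\<^sup>2" using first_moment[OF ad] by (simp add: e1_def Y_def[abs_def] m_def x_def)
  have e2: "\<bar>e2 - 8 / 15 * x\<bar> \<le> x\<^sup>2" using second_moment[OF ad] by (simp add: e2_def Y_def[abs_def] x_def)
  have EW: "expectation W = c * (e1 - m)"
    using int by (simp add: W_def[abs_def] e1_def prob_space)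
  have "(W \<omega>)\<^sup>2 = c\<^sup>2 * ((Y \<omega>)\<^sup>2 - 2 * m * Y \<omega> + m\<^sup>2)" for \<omega>
    by (simp add: W_def power2_eq_square algebra_simps)
  then have EW2: "expectation (\<lambda>\<omega>. (W \<omega>)\<^sup>2) = c\<^sup>2 * (e2 - 2 * m * e1 + m\<^sup>2)"
    using int by (simp add: e1_def e2_def prob_space)
  \<comment> \<open>One \<open>x\<^sup>2\<close> comes from \<open>e2\<close>; the centring adds
    \<open>m * (2 * e1 - m)\<close>, at most \<open>8 / 3 * x\<^sup>2\<close>, which is rounded up
    to three.\<close>
  have "\<bar>e2 - 2 * m * e1 + m\<^sup>2 - 8 / 15 * x\<bar> \<le> 4 * x\<^sup>2"
  proof -
    have "0 \<le> e1" unfolding e1_def using Y01 by (intro Bochner_Integration.integral_nonneg_AE AE_I2) auto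
    moreover have "x\<^sup>2 \<le> x" using x0 x1 by (simp add: power2_eq_square mult_left_le)
    ultimately have "\<bar>2 * e1 - m\<bar> \<le> 4 * x" using e1 x0 by (simp add: m_def abs_le_iff)
    then have "m * \<bar>2 * e1 - m\<bar> \<le> m * (4 * x)" using x0 by (intro mult_left_mono) (auto simp: m_def)
    also have "\<dots> \<le> 3 * x\<^sup>2" by (simp add: m_def power2_eq_square)
    finally have "\<bar>m * (2 * e1 - m)\<bar> \<le> 3 * x\<^sup>2" using x0 by (simp add: abs_mult m_def)
    moreover have "e2 - 2 * m * e1 + m\<^sup>2 - 8 / 15 * x = (e2 - 8 / 15 * x) - m * (2 * e1 - m)"
      by (simp add: algebra_simps power2_eq_square)
    ultimately show ?thesis using e2 by linarith
  qed
  then have "c\<^sup>2 * \<bar>e2 - 2 * m * e1 + m\<^sup>2 - 8 / 15 * x\<bar> \<le> c\<^sup>2 * (4 * x\<^sup>2)"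
    by (intro mult_left_mono) auto
  then have q: "\<bar>expectation (\<lambda>\<omega>. (W \<omega>)\<^sup>2) - 8 / 15 * c\<^sup>2 * x\<bar> \<le> 4 * c\<^sup>2 * x\<^sup>2"
    unfolding EW2 by (simp add: abs_mult_pos' algebra_simps)
  have "cmod (expectation (\<lambda>\<omega>. iexp (W \<omega>)) - (1 - of_real k)) \<le>
    \<bar>expectation W\<bar> + \<bar>expectation (\<lambda>\<omega>. (W \<omega>)\<^sup>2) / 2 - k\<bar> + \<bar>c\<bar> / 6 * expectation (\<lambda>\<omega>. (W \<omega>)\<^sup>2)"
    by (rule expectation_iexp_approx) (use Wb in auto)
  also have "\<bar>expectation W\<bar> \<le> \<bar>c\<bar> * x\<^sup>2"
    unfolding EW abs_mult using e1 by (intro mult_left_mono) auto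
  also have "\<bar>expectation (\<lambda>\<omega>. (W \<omega>)\<^sup>2) / 2 - k\<bar> \<le> \<bar>4 / 15 * c\<^sup>2 * x - k\<bar> + 2 * c\<^sup>2 * x\<^sup>2"
    using q by (simp add: abs_le_iff) linarith
  also have "\<bar>c\<bar> / 6 * expectation (\<lambda>\<omega>. (W \<omega>)\<^sup>2) \<le> \<bar>c\<bar> / 6 * (c\<^sup>2 * (8 / 15 * x + 4 * x\<^sup>2))"
    using q by (intro mult_left_mono) (auto simp: algebra_simps)
  finally show ?thesis by (simp add: W_def Y_def m_def)
qed

text \<open>The conditions on the scaling \<open>c\<close> play separate roles: \<open>c\<close>
  tending to 0 removes the cubic remainder, the second condition removes the accumulated bias, and
  the third fixes the variance through \<open>\<kappa>\<close>.\<close>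

lemma char_sum_mean_sign_tendsto:
  fixes \<Delta> c :: "nat \<Rightarrow> real" and s \<kappa> :: real
  assumes \<Delta>: "\<And>n. n \<ge> 1 \<Longrightarrow> \<Delta> n > 0" "\<Delta> \<longlonglongrightarrow> 0"
    and c: "c \<longlonglongrightarrow> 0" "(\<lambda>n. real n * c n * (\<Delta> n)\<^sup>2) \<longlonglongrightarrow> 0" "(\<lambda>n. real n * (c n)\<^sup>2 * \<Delta> n) \<longlonglongrightarrow> \<kappa>"
  shows "(\<lambda>n. expectation (\<lambda>\<omega>. iexp (s * (c n *
      (\<Sum>i<n. 1 - (mean_sign (real i * \<Delta> n) (\<Delta> n) \<omega>)\<^sup>2 - 2 / 3 * (rate * \<Delta> n))))))
    \<longlonglongrightarrow> of_real (exp (- (4 / 15 * \<kappa> * rate * s\<^sup>2)))"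
proof -
  define L where "L = 4 / 15 * \<kappa> * rate * s\<^sup>2"
  define z where "z n i = expectation (\<lambda>\<omega>. iexp (s * c n *
      (1 - (mean_sign (real i * \<Delta> n) (\<Delta> n) \<omega>)\<^sup>2 - 2 / 3 * (rate * \<Delta> n))))" for n i
  \<comment> \<open>The bound of \<open>char_term_approx\<close> with \<open>s * c n\<close> for the
    scaling and \<open>L / n\<close> for \<open>k\<close>.\<close>
  define B where "B n = \<bar>s * c n\<bar> * (rate * \<Delta> n)\<^sup>2 + \<bar>4 / 15 * (s * c n)\<^sup>2 * (rate * \<Delta> n) - L / real n\<bar> +
      2 * (s * c n)\<^sup>2 * (rate * \<Delta> n)\<^sup>2 +
      \<bar>s * c n\<bar> / 6 * ((s * c n)\<^sup>2 * (8 / 15 * (rate * \<Delta> n) + 4 * (rate * \<Delta> n)\<^sup>2))" for n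
  \<comment> \<open>The product limit requires \<open>L \<ge> 0\<close>; \<open>\<kappa>\<close> is
    a limit of terms that are nonnegative from \<open>n = 1\<close> on.\<close>
  have "0 \<le> \<kappa>"
    using \<Delta>(1) by (intro tendsto_lowerbound[OF c(3)] eventually_sequentiallyI[of 1] mult_nonneg_nonneg)
      (simp_all add: less_imp_le)
  then have L: "0 \<le> L" using rate_pos by (simp add: L_def)
  have "(\<lambda>n. \<Prod>i<n. z n i) \<longlonglongrightarrow> of_real (exp (- L))"
  proof (rule prod_tendsto_exp[OF L])
    show "norm (z n i) \<le> 1" if "i < n" for n i
    proof -
      have [measurable]: "mean_sign (real i * \<Delta> n) (\<Delta> n) \<in> borel_measurable M"
        using that \<Delta>(1)[of n] by (intro mean_sign_measurable) auto
      have "norm (z n i) \<le> expectation (\<lambda>_. 1)"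
        unfolding z_def
        by (intro order_trans[OF integral_norm_bound integral_mono] integrable_norm integrable_const_bound[of _ 1] AE_I2) auto
      then show ?thesis by (simp add: prob_space)
    qed
    have "(\<lambda>n. rate * \<Delta> n) \<longlonglongrightarrow> rate * 0" by (intro tendsto_intros \<Delta>)
    then have "\<forall>\<^sub>F n in sequentially. rate * \<Delta> n < 1" by (intro order_tendstoD) auto
    then show "\<forall>\<^sub>F n in sequentially. \<forall>i<n. norm (z n i - (1 - of_real (L / real n))) \<le> B n"
    proof eventually_elim
      case (elim n)
      show ?case
      proof (intro allI impI)
        fix i assume "i < n"
        then have "\<Delta> n > 0" using \<Delta>(1)[of n] by simp
        then show "norm (z n i - (1 - of_real (L / real n))) \<le> B n"
          unfolding z_def B_def using elim by (intro char_term_approx) auto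
      qed
    qed
    \<comment> \<open>This is \<open>n * B n\<close> in terms of the quantities with known limits.
      The second summand vanishes in the limit by the choice of \<open>L\<close>, each of the others
      by a null factor.\<close>
    have "(\<lambda>n. rate\<^sup>2 * \<bar>s\<bar> * \<bar>real n * c n * (\<Delta> n)\<^sup>2\<bar> +
        \<bar>4 / 15 * s\<^sup>2 * rate * (real n * (c n)\<^sup>2 * \<Delta> n) - L\<bar> +
        2 * s\<^sup>2 * rate\<^sup>2 * (real n * (c n)\<^sup>2 * \<Delta> n) * \<Delta> n +
        \<bar>s * c n\<bar> / 6 * s\<^sup>2 * (8 / 15 * rate * (real n * (c n)\<^sup>2 * \<Delta> n) +
          4 * rate\<^sup>2 * (real n * (c n)\<^sup>2 * \<Delta> n) * \<Delta> n))
      \<longlonglongrightarrow> rate\<^sup>2 * \<bar>s\<bar> * \<bar>0\<bar> + \<bar>4 / 15 * s\<^sup>2 * rate * \<kappa> - L\<bar> + 2 * s\<^sup>2 * rate\<^sup>2 * \<kappa> * 0 +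
        \<bar>s * 0\<bar> / 6 * s\<^sup>2 * (8 / 15 * rate * \<kappa> + 4 * rate\<^sup>2 * \<kappa> * 0)" (is "?F \<longlonglongrightarrow> _")
      by (intro tendsto_intros c \<Delta>) auto
    then have "?F \<longlonglongrightarrow> 0" by (simp add: L_def mult.commute mult.left_commute)
    moreover have "\<forall>\<^sub>F n in sequentially. ?F n = real n * B n"
    proof (rule eventually_sequentiallyI[of 1])
      fix n :: nat assume n: "1 \<le> n"
      have "real n * \<bar>4 / 15 * (s * c n)\<^sup>2 * (rate * \<Delta> n) - L / real n\<bar> =
          \<bar>real n * (4 / 15 * (s * c n)\<^sup>2 * (rate * \<Delta> n) - L / real n)\<bar>"
        by (simp add: abs_mult)
      also have "real n * (4 / 15 * (s * c n)\<^sup>2 * (rate * \<Delta> n) - L / real n) =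
          4 / 15 * s\<^sup>2 * rate * (real n * (c n)\<^sup>2 * \<Delta> n) - L"
        using n by (simp add: field_simps power_mult_distrib)
      finally have "real n * \<bar>4 / 15 * (s * c n)\<^sup>2 * (rate * \<Delta> n) - L / real n\<bar> =
          \<bar>4 / 15 * s\<^sup>2 * rate * (real n * (c n)\<^sup>2 * \<Delta> n) - L\<bar>" .
      then show "?F n = real n * B n"
        unfolding B_def distrib_left by (simp add: abs_mult power_mult_distrib power2_eq_square algebra_simps)
    qed
    ultimately show "(\<lambda>n. real n * B n) \<longlonglongrightarrow> 0"
      by (rule Lim_transform_eventually)
  qed
  moreover have "\<forall>\<^sub>F n in sequentially. (\<Prod>i<n. z n i) = expectation (\<lambda>\<omega>. iexp (s * (c n *
      (\<Sum>i<n. 1 - (mean_sign (real i * \<Delta> n) (\<Delta> n) \<omega>)\<^sup>2 - 2 / 3 * (rate * \<Delta> n)))))"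
    unfolding z_def mult.assoc[symmetric, of s "c _"]
    using iexp_sum_mean_sign[OF \<Delta>(1)]
    by (intro eventually_sequentiallyI[of 1]) (simp only:)
  ultimately show ?thesis
    unfolding L_def by (rule Lim_transform_eventually)
qed

end

subsection \<open>The estimator\<close>

lemma real_distribution_normal:
  assumes "0 < s2"
  shows "real_distribution (normal_distribution 0 s2)"
  using prob_space_normal_density[of "sqrt s2" 0] assms
  by (simp add: normal_distribution_def real_distribution_def real_distribution_axioms_def)

text \<open>Scaling reduces the characteristic function to that of the standard normal law.\<close>

lemma normal_distribution_eq_distr:
  assumes "0 < s2"
  shows "normal_distribution 0 s2 = distr std_normal_distribution borel (\<lambda>x. sqrt s2 * x)"
proof -
  interpret S: real_distribution std_normal_distribution by (rule real_dist_normal_dist)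
  have "distributed std_normal_distribution lborel (\<lambda>x. x) std_normal_density"
    unfolding distributed_def by (auto intro!: distr_id2)
  from S.normal_density_affine[OF this, of "sqrt s2" 0] assms
  have "distributed std_normal_distribution lborel (\<lambda>x. sqrt s2 * x) (normal_density 0 (sqrt s2))"
    by simp
  then have "distr std_normal_distribution lborel (\<lambda>x. sqrt s2 * x) = normal_distribution 0 s2"
    by (simp add: distributed_def normal_distribution_def)
  then show ?thesis by (simp cong: distr_cong)
qed

lemma char_normal_distribution:
  assumes "0 < s2"
  shows "char (normal_distribution 0 s2) t = of_real (exp (- (s2 / 2 * t\<^sup>2)))"
proof -
  have "char (normal_distribution 0 s2) t = char std_normal_distribution (t * sqrt s2)"
    unfolding normal_distribution_eq_distr[OF assms] char_def
    by (subst integral_distr) (simp_all add: mult.assoc)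
  then show ?thesis
    using assms by (simp add: char_std_normal_distribution power_mult_distrib mult.commute)
qed

lemma (in prob_space) char_distr:
  assumes [measurable]: "Z \<in> borel_measurable M"
  shows "char (distr M borel Z) t = expectation (\<lambda>\<omega>. iexp (t * Z \<omega>))"
  unfolding char_def by (subst integral_distr) auto

text \<open>By Levy's theorem \<open>Z n - c\<close> converges weakly to the point mass at 0, whose
  distribution function is continuous away from 0. With \<open>F\<close> the distribution function
  of \<open>Z n - c\<close>, the deviation probability is at most
  \<open>F (- \<epsilon>) + 1 - F \<epsilon>\<close>, which tends to 0.\<close>

lemma (in prob_space) converges_in_prob_of_char:
  assumes meas: "\<And>n. Z n \<in> borel_measurable M"
    and char: "\<And>t. (\<lambda>n. expectation (\<lambda>\<omega>. iexp (t * (Z n \<omega> - c)))) \<longlonglongrightarrow> 1"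
  shows "converges_in_prob M Z c"
proof -
  note [measurable] = meas
  define Y where "Y n \<omega> = Z n \<omega> - c" for n \<omega>
  have [measurable]: "Y n \<in> borel_measurable M" for n unfolding Y_def[abs_def] by measurable
  have D: "real_distribution (distr M borel (Y n))" for n by (rule real_distribution_distr) simp
  have R: "real_distribution (return borel (0 :: real))"
    by (simp add: real_distribution_def real_distribution_axioms_def prob_space_return)
  have weak: "weak_conv_m (\<lambda>n. distr M borel (Y n)) (return borel 0)"
  proof (rule levy_continuity[OF D R])
    fix t
    have "char (return borel 0) t = 1" by (simp add: char_def integral_return)
    then show "(\<lambda>n. char (distr M borel (Y n)) t) \<longlonglongrightarrow> char (return borel 0) t"
      using char[of t] by (simp add: char_distr Y_def)
  qed
  have cdf_return: "cdf (return borel (0 :: real)) = (\<lambda>x. if 0 \<le> x then 1 else 0)"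
    by (auto simp: cdf_def measure_return fun_eq_iff indicator_def)
  have cdf_lim: "(\<lambda>n. prob {\<omega> \<in> space M. Y n \<omega> \<le> x}) \<longlonglongrightarrow> (if 0 \<le> x then 1 else 0)" if "x \<noteq> 0" for x
  proof -
    have "isCont (cdf (return borel (0 :: real))) x"
    proof (rule continuous_at_within_cong[THEN iffD1])
      show "isCont (\<lambda>_. if 0 \<le> x then 1 else 0 :: real) x" by simp
      have "\<forall>\<^sub>F y in nhds x. y \<in> (if 0 < x then {0<..} else {..<0})"
        using that by (intro eventually_nhds_in_open) auto
      then show "\<forall>\<^sub>F y in at x. (if 0 \<le> x then 1 else 0) = cdf (return borel 0) y"
        unfolding eventually_at_filter by eventually_elim (use that in \<open>auto simp: cdf_return split: if_splits\<close>)
    qed (simp add: cdf_return)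
    then have "(\<lambda>n. cdf (distr M borel (Y n)) x) \<longlonglongrightarrow> cdf (return borel 0) x"
      using weak by (simp add: weak_conv_m_def weak_conv_def)
    moreover have "cdf (distr M borel (Y n)) x = prob {\<omega> \<in> space M. Y n \<omega> \<le> x}" for n
      by (auto simp: cdf_def measure_distr intro!: arg_cong[where f=prob])
    ultimately show ?thesis by (simp add: cdf_return)
  qed
  have "(\<lambda>n. prob {\<omega> \<in> space M. \<bar>Z n \<omega> - c\<bar> > \<epsilon>}) \<longlonglongrightarrow> 0" if "\<epsilon> > 0" for \<epsilon>
  proof (rule tendsto_sandwich[OF _ _ tendsto_const])
    have "(\<lambda>n. prob {\<omega> \<in> space M. Y n \<omega> \<le> - \<epsilon>} + (1 - prob {\<omega> \<in> space M. Y n \<omega> \<le> \<epsilon>})) \<longlonglongrightarrow> 0 + (1 - 1)"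
      using cdf_lim[of "- \<epsilon>"] cdf_lim[of \<epsilon>] that by (intro tendsto_intros) auto
    then show "(\<lambda>n. prob {\<omega> \<in> space M. Y n \<omega> \<le> - \<epsilon>} + (1 - prob {\<omega> \<in> space M. Y n \<omega> \<le> \<epsilon>})) \<longlonglongrightarrow> 0"
      by simp
    have "prob {\<omega> \<in> space M. \<bar>Z n \<omega> - c\<bar> > \<epsilon>} \<le>
        prob {\<omega> \<in> space M. Y n \<omega> \<le> - \<epsilon>} + (1 - prob {\<omega> \<in> space M. Y n \<omega> \<le> \<epsilon>})" for n
    proof -
      have "prob {\<omega> \<in> space M. \<bar>Z n \<omega> - c\<bar> > \<epsilon>} \<le>
          prob ({\<omega> \<in> space M. Y n \<omega> \<le> - \<epsilon>} \<union> (space M - {\<omega> \<in> space M. Y n \<omega> \<le> \<epsilon>}))"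
        by (intro finite_measure_mono) (auto simp: Y_def)
      also have "\<dots> \<le> prob {\<omega> \<in> space M. Y n \<omega> \<le> - \<epsilon>} + prob (space M - {\<omega> \<in> space M. Y n \<omega> \<le> \<epsilon>})"
        by (intro measure_Un_le) auto
      also have "prob (space M - {\<omega> \<in> space M. Y n \<omega> \<le> \<epsilon>}) = 1 - prob {\<omega> \<in> space M. Y n \<omega> \<le> \<epsilon>}"
        by (intro prob_compl) auto
      finally show ?thesis .
    qed
    then show "\<forall>\<^sub>F n in sequentially. prob {\<omega> \<in> space M. \<bar>Z n \<omega> - c\<bar> > \<epsilon>} \<le>
        prob {\<omega> \<in> space M. Y n \<omega> \<le> - \<epsilon>} + (1 - prob {\<omega> \<in> space M. Y n \<omega> \<le> \<epsilon>})" by simp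
  qed simp
  then show ?thesis by (simp add: converges_in_prob_def)
qed

section \<open>Reduction of the estimator to mean signs, and its two limits\<close>

context telegraph_process
begin

text \<open>Squaring removes the random sign of \<open>V\<close>. The \<open>i\<close>-th interval
  starts at \<open>(i - 1) * \<Delta> n\<close>, and \<open>1 \<le> i\<close> makes natural and real
  subtraction agree.\<close>

lemma increment_sq:
  assumes "\<omega> \<in> space M" "0 < \<Delta> n" "1 \<le> i"
  shows "(increment X (\<Delta> n) i \<omega>)\<^sup>2 / (v\<^sup>2 * (\<Delta> n)\<^sup>2) =
    (mean_sign (real (i - 1) * \<Delta> n) (\<Delta> n) \<omega>)\<^sup>2"
proof -
  have V2: "(V \<omega>)\<^sup>2 = v\<^sup>2" using V_values[OF assms(1)] by auto
  define a where "a = real (i - 1) * \<Delta> n"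
  have a: "0 \<le> a" "real i * \<Delta> n = a + \<Delta> n" "(real i - 1) * \<Delta> n = a"
    using assms(2,3) by (simp_all add: a_def of_nat_diff algebra_simps)
  have "increment X (\<Delta> n) i \<omega> = V \<omega> * (mean_sign a (\<Delta> n) \<omega> * \<Delta> n)"
    using X_eq[OF assms(1), of a] X_eq[OF assms(1), of "a + \<Delta> n"] a(1) assms(2)
    by (simp add: increment_def a(2,3) mean_sign_def alt_int_def right_diff_distrib)
  then have "(increment X (\<Delta> n) i \<omega>)\<^sup>2 = v\<^sup>2 * ((mean_sign a (\<Delta> n) \<omega>)\<^sup>2 * (\<Delta> n)\<^sup>2)"
    by (simp add: power_mult_distrib V2)
  then show ?thesis using v_pos assms(2) by (simp add: a_def)
qed

lemma lambda_star_eq: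
  assumes "\<omega> \<in> space M" "0 < \<Delta> n"
  shows "lambda_star v \<Delta> X n \<omega> = 3 / 2 * (1 / (real n * \<Delta> n)) *
    (\<Sum>i<n. 1 - (mean_sign (real i * \<Delta> n) (\<Delta> n) \<omega>)\<^sup>2)"
proof -
  have "(\<Sum>i=1..n. 1 - (increment X (\<Delta> n) i \<omega>)\<^sup>2 / (v\<^sup>2 * (\<Delta> n)\<^sup>2)) =
      (\<Sum>i=1..n. 1 - (mean_sign (real (i - 1) * \<Delta> n) (\<Delta> n) \<omega>)\<^sup>2)"
    using increment_sq[where \<Delta>=\<Delta> and n=n, OF assms] by (intro sum.cong) auto
  also have "\<dots> = (\<Sum>i<n. 1 - (mean_sign (real i * \<Delta> n) (\<Delta> n) \<omega>)\<^sup>2)"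
    by (rule sum.reindex_bij_witness[of _ Suc "\<lambda>i. i - 1"]) auto
  finally show ?thesis by (simp add: lambda_star_def)
qed

text \<open>The \<open>n\<close> centring terms \<open>2 / 3 * (rate * \<Delta> n)\<close>,
  multiplied by the prefactor, add up to exactly \<open>rate\<close>.\<close>

lemma lambda_star_error:
  assumes "\<omega> \<in> space M" "0 < \<Delta> n" "1 \<le> n"
  shows "lambda_star v \<Delta> X n \<omega> - rate = 3 / 2 / (real n * \<Delta> n) *
    (\<Sum>i<n. 1 - (mean_sign (real i * \<Delta> n) (\<Delta> n) \<omega>)\<^sup>2 - 2 / 3 * (rate * \<Delta> n))"
proof -
  define S where "S = (\<Sum>i<n. 1 - (mean_sign (real i * \<Delta> n) (\<Delta> n) \<omega>)\<^sup>2)"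
  have "(\<Sum>i<n. 1 - (mean_sign (real i * \<Delta> n) (\<Delta> n) \<omega>)\<^sup>2 - 2 / 3 * (rate * \<Delta> n)) =
      S - real n * (2 / 3 * (rate * \<Delta> n))"
    unfolding S_def by (subst sum_subtractf) simp
  moreover have "lambda_star v \<Delta> X n \<omega> = 3 / 2 * (1 / (real n * \<Delta> n)) * S"
    unfolding S_def using assms(1,2) by (rule lambda_star_eq)
  ultimately show ?thesis using assms(2,3) by (simp add: field_simps)
qed

lemma lambda_star_measurable:
  assumes "n \<ge> 1 \<Longrightarrow> 0 < \<Delta> n"
  shows "lambda_star v \<Delta> X n \<in> borel_measurable M"
proof (cases "n = 0")
  \<comment> \<open>\<open>\<Delta> 0\<close> is unconstrained, but for \<open>n = 0\<close> the sum
    is empty and the estimator constant.\<close>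
  case True
  then show ?thesis by (simp add: lambda_star_def[abs_def])
next
  case False
  with assms have "0 < \<Delta> n" by simp
  then have [measurable]: "mean_sign (real i * \<Delta> n) (\<Delta> n) \<in> borel_measurable M" for i
    by (intro mean_sign_measurable) auto
  have "(\<lambda>\<omega>. 3 / 2 * (1 / (real n * \<Delta> n)) *
    (\<Sum>i<n. 1 - (mean_sign (real i * \<Delta> n) (\<Delta> n) \<omega>)\<^sup>2)) \<in> borel_measurable M"
    by measurable
  then show ?thesis
    using lambda_star_eq \<open>0 < \<Delta> n\<close> by (subst measurable_cong) auto
qed

text \<open>Serves both conclusions, with \<open>b\<close> the normalisation. The conditions on
  \<open>b\<close> say that single summands become negligible, that the normalised bias vanishes and
  that the variance converges.\<close>

lemma char_lambda_star_tendsto: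
  fixes \<Delta> b :: "nat \<Rightarrow> real" and t \<kappa> :: real
  assumes \<Delta>: "\<And>n. n \<ge> 1 \<Longrightarrow> \<Delta> n > 0" "\<Delta> \<longlonglongrightarrow> 0"
    and b: "(\<lambda>n. b n / (real n * \<Delta> n)) \<longlonglongrightarrow> 0" "(\<lambda>n. b n * \<Delta> n) \<longlonglongrightarrow> 0"
      "(\<lambda>n. (b n)\<^sup>2 / (real n * \<Delta> n)) \<longlonglongrightarrow> \<kappa>"
  shows "(\<lambda>n. expectation (\<lambda>\<omega>. iexp (t * (b n * (lambda_star v \<Delta> X n \<omega> - rate)))))
    \<longlonglongrightarrow> of_real (exp (- (3 / 5 * \<kappa> * rate * t\<^sup>2)))"
proof -
  define c where "c n = 3 / 2 * (b n / (real n * \<Delta> n))" for n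
  have "c \<longlonglongrightarrow> 0" using tendsto_mult_left[OF b(1), of "3 / 2"] by (simp add: c_def[abs_def])
  moreover have "(\<lambda>n. real n * c n * (\<Delta> n)\<^sup>2) \<longlonglongrightarrow> 0"
  proof (rule Lim_transform_eventually)
    show "(\<lambda>n. 3 / 2 * (b n * \<Delta> n)) \<longlonglongrightarrow> 0" using tendsto_mult_left[OF b(2), of "3 / 2"] by simp
    show "\<forall>\<^sub>F n in sequentially. 3 / 2 * (b n * \<Delta> n) = real n * c n * (\<Delta> n)\<^sup>2"
      using \<Delta>(1) by (intro eventually_sequentiallyI[of 1]) (force simp: c_def power2_eq_square)
  qed
  moreover have "(\<lambda>n. real n * (c n)\<^sup>2 * \<Delta> n) \<longlonglongrightarrow> 9 / 4 * \<kappa>"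
  proof (rule Lim_transform_eventually)
    show "(\<lambda>n. 9 / 4 * ((b n)\<^sup>2 / (real n * \<Delta> n))) \<longlonglongrightarrow> 9 / 4 * \<kappa>"
      by (rule tendsto_mult_left[OF b(3)])
    show "\<forall>\<^sub>F n in sequentially. 9 / 4 * ((b n)\<^sup>2 / (real n * \<Delta> n)) = real n * (c n)\<^sup>2 * \<Delta> n"
      using \<Delta>(1) by (intro eventually_sequentiallyI[of 1]) (force simp: c_def power2_eq_square)
  qed
  ultimately have lim: "(\<lambda>n. expectation (\<lambda>\<omega>. iexp (t * (c n *
      (\<Sum>i<n. 1 - (mean_sign (real i * \<Delta> n) (\<Delta> n) \<omega>)\<^sup>2 - 2 / 3 * (rate * \<Delta> n))))))
    \<longlonglongrightarrow> of_real (exp (- (4 / 15 * (9 / 4 * \<kappa>) * rate * t\<^sup>2)))"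
    by (intro char_sum_mean_sign_tendsto \<Delta>)
  \<comment> \<open>The \<open>9 / 4\<close> is the square of the prefactor \<open>3 / 2\<close>;
    the resulting \<open>3 / 5\<close> is half of the variance constant
    \<open>6 / 5\<close>.\<close>
  have "4 / 15 * (9 / 4 * \<kappa>) * rate * t\<^sup>2 = 3 / 5 * \<kappa> * rate * t\<^sup>2" by simp
  note lim [unfolded this]
  moreover have "\<forall>\<^sub>F n in sequentially. expectation (\<lambda>\<omega>. iexp (t * (c n *
      (\<Sum>i<n. 1 - (mean_sign (real i * \<Delta> n) (\<Delta> n) \<omega>)\<^sup>2 - 2 / 3 * (rate * \<Delta> n))))) =
      expectation (\<lambda>\<omega>. iexp (t * (b n * (lambda_star v \<Delta> X n \<omega> - rate))))"
  proof (rule eventually_sequentiallyI[of 1])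
    fix n :: nat assume n: "1 \<le> n"
    then have "b n * (lambda_star v \<Delta> X n \<omega> - rate) = c n *
        (\<Sum>i<n. 1 - (mean_sign (real i * \<Delta> n) (\<Delta> n) \<omega>)\<^sup>2 - 2 / 3 * (rate * \<Delta> n))"
      if "\<omega> \<in> space M" for \<omega>
      unfolding lambda_star_error[where \<Delta>=\<Delta> and n=n, OF that \<Delta>(1)[OF n] n] by (simp add: c_def)
    then show "expectation (\<lambda>\<omega>. iexp (t * (c n *
      (\<Sum>i<n. 1 - (mean_sign (real i * \<Delta> n) (\<Delta> n) \<omega>)\<^sup>2 - 2 / 3 * (rate * \<Delta> n))))) =
      expectation (\<lambda>\<omega>. iexp (t * (b n * (lambda_star v \<Delta> X n \<omega> - rate))))"
      by (intro Bochner_Integration.integral_cong) simp_all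
  qed
  ultimately show ?thesis
    by (rule Lim_transform_eventually)
qed

text \<open>Take \<open>b n = 1\<close>: the bias is of order \<open>\<Delta> n\<close> and the
  variance of order \<open>1 / (n * \<Delta> n)\<close>, so \<open>\<kappa> = 0\<close> and the
  characteristic functions of the error tend to 1.\<close>

lemma lambda_star_consistent:
  assumes \<Delta>: "\<And>n. n \<ge> 1 \<Longrightarrow> \<Delta> n > 0" "\<Delta> \<longlonglongrightarrow> 0"
    and T: "filterlim (\<lambda>n. real n * \<Delta> n) at_top sequentially"
  shows "converges_in_prob M (lambda_star v \<Delta> X) rate"
proof (rule converges_in_prob_of_char)
  show "lambda_star v \<Delta> X n \<in> borel_measurable M" for n
    using \<Delta>(1) by (rule lambda_star_measurable)
  have "(\<lambda>n. 1 / (real n * \<Delta> n)) \<longlonglongrightarrow> 0"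
    using tendsto_inverse_0_at_top[OF T] by (simp add: inverse_eq_divide)
  then show "(\<lambda>n. expectation (\<lambda>\<omega>. iexp (t * (lambda_star v \<Delta> X n \<omega> - rate)))) \<longlonglongrightarrow> 1" for t
    using char_lambda_star_tendsto[OF \<Delta>, of "\<lambda>_. 1" 0 t] \<Delta>(2) by simp
qed

text \<open>Take \<open>b n = sqrt (n * \<Delta> n)\<close>: then \<open>\<kappa> = 1\<close>, and
  the limit \<open>exp (- (3 / 5 * rate * t\<^sup>2))\<close> is the characteristic function of the
  centred normal law with variance \<open>6 / 5 * rate\<close>.\<close>

lemma lambda_star_asymptotic_normality:
  assumes \<Delta>: "\<And>n. n \<ge> 1 \<Longrightarrow> \<Delta> n > 0" "\<Delta> \<longlonglongrightarrow> 0"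
    and T: "filterlim (\<lambda>n. real n * \<Delta> n) at_top sequentially"
    and \<Delta>3: "(\<lambda>n. real n * \<Delta> n ^ 3) \<longlonglongrightarrow> 0"
  shows "converges_in_distr M (\<lambda>n \<omega>. sqrt (real n * \<Delta> n) * (lambda_star v \<Delta> X n \<omega> - rate))
    (normal_distribution 0 (6 / 5 * rate))"
proof -
  let ?b = "\<lambda>n. sqrt (real n * \<Delta> n)"
  have meas: "(\<lambda>\<omega>. ?b n * (lambda_star v \<Delta> X n \<omega> - rate)) \<in> borel_measurable M" for n
    using lambda_star_measurable[OF \<Delta>(1)] by (intro borel_measurable_times borel_measurable_diff) auto
  have s2: "0 < 6 / 5 * rate" using rate_pos by simp
  have T_pos: "0 < real n * \<Delta> n" if "1 \<le> n" for n using \<Delta>(1)[OF that] that by simp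
  have b: "(\<lambda>n. ?b n / (real n * \<Delta> n)) \<longlonglongrightarrow> 0"
  proof (rule Lim_transform_eventually)
    show "(\<lambda>n. inverse (?b n)) \<longlonglongrightarrow> 0"
      by (intro tendsto_inverse_0_at_top filterlim_compose[OF sqrt_at_top T])
    show "\<forall>\<^sub>F n in sequentially. inverse (?b n) = ?b n / (real n * \<Delta> n)"
      using T_pos by (intro eventually_sequentiallyI[of 1]) (simp only: sqrt_divide_self_eq less_imp_le)
  qed
  \<comment> \<open>The normalised bias is the square root of \<open>n * \<Delta> n ^ 3\<close>;
    this is where the extra rate condition enters.\<close>
  have b2: "(\<lambda>n. ?b n * \<Delta> n) \<longlonglongrightarrow> 0"
  proof (rule Lim_transform_eventually)
    show "(\<lambda>n. sqrt (real n * \<Delta> n ^ 3)) \<longlonglongrightarrow> 0" using tendsto_real_sqrt[OF \<Delta>3] by simp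
    show "\<forall>\<^sub>F n in sequentially. sqrt (real n * \<Delta> n ^ 3) = ?b n * \<Delta> n"
    proof (rule eventually_sequentiallyI[of 1])
      fix n :: nat assume "1 \<le> n"
      have "real n * \<Delta> n ^ 3 = real n * \<Delta> n * (\<Delta> n)\<^sup>2" by (simp add: power3_eq_cube power2_eq_square)
      then show "sqrt (real n * \<Delta> n ^ 3) = ?b n * \<Delta> n"
        using \<Delta>(1)[OF \<open>1 \<le> n\<close>] by (simp only: real_sqrt_mult) simp
    qed
  qed
  have b3: "(\<lambda>n. (?b n)\<^sup>2 / (real n * \<Delta> n)) \<longlonglongrightarrow> 1"
  proof (rule Lim_transform_eventually[OF tendsto_const])
    show "\<forall>\<^sub>F n in sequentially. 1 = (?b n)\<^sup>2 / (real n * \<Delta> n)"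
      proof (rule eventually_sequentiallyI[of 1])
      fix n :: nat assume "1 \<le> n"
      from T_pos[OF this] have nz: "0 \<le> real n * \<Delta> n" "real n * \<Delta> n \<noteq> 0" by linarith+
      show "1 = (?b n)\<^sup>2 / (real n * \<Delta> n)"
        unfolding real_sqrt_pow2[OF nz(1)] divide_self[OF nz(2)] ..
    qed
  qed
  have "weak_conv_m (\<lambda>n. distr M borel (\<lambda>\<omega>. ?b n * (lambda_star v \<Delta> X n \<omega> - rate)))
      (normal_distribution 0 (6 / 5 * rate))"
  proof (rule levy_continuity)
    show "real_distribution (distr M borel (\<lambda>\<omega>. ?b n * (lambda_star v \<Delta> X n \<omega> - rate)))" for n
      by (rule real_distribution_distr[OF meas])
    show "real_distribution (normal_distribution 0 (6 / 5 * rate))"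
      by (rule real_distribution_normal[OF s2])
    show "(\<lambda>n. char (distr M borel (\<lambda>\<omega>. ?b n * (lambda_star v \<Delta> X n \<omega> - rate))) t)
        \<longlonglongrightarrow> char (normal_distribution 0 (6 / 5 * rate)) t" for t
      unfolding char_distr[OF meas] char_normal_distribution[OF s2]
      using char_lambda_star_tendsto[OF \<Delta> b b2 b3, of t] by simp
  qed
  then show ?thesis using meas by (simp add: converges_in_distr_def)
qed

end

theorem theorem3p2:
  fixes M :: "'a measure" and N :: "real \<Rightarrow> 'a \<Rightarrow> nat" and V :: "'a \<Rightarrow> real"
    and X :: "real \<Rightarrow> 'a \<Rightarrow> real" and v lambda0 :: real and \<Delta> :: "nat \<Rightarrow> real"
  assumes "v > 0" and "lambda0 > 0"
    and "telegraph_process M lambda0 N v V X"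
    and "\<And>n. n \<ge> 1 \<Longrightarrow> \<Delta> n > 0"
    and "\<Delta> \<longlonglongrightarrow> 0"
    and "filterlim (\<lambda>n. real n * \<Delta> n) at_top sequentially"
  shows "converges_in_prob M (lambda_star v \<Delta> X) lambda0 \<and>
    ((\<lambda>n. real n * \<Delta> n ^ 3) \<longlonglongrightarrow> 0 \<longrightarrow>
      converges_in_distr M
        (\<lambda>n \<omega>. sqrt (real n * \<Delta> n) * (lambda_star v \<Delta> X n \<omega> - lambda0))
        (normal_distribution 0 (6 / 5 * lambda0)))"
proof -
  interpret telegraph_process M lambda0 N v V X by fact
  show ?thesis
    using lambda_star_consistent[OF assms(4-6)] lambda_star_asymptotic_normality[OF assms(4-6)] by blast
qed

end
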